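(* Let $\hat\beta_1,\dots,\hat\beta_5>0$ be $$\hat\beta_1=\sqrt{\mu_s}\Big(\frac{3\sqrt\mu}{2}+L\Big),\quad \hat\beta_2=\frac32\sqrt\mu\sqrt{\mu_s},\quad \hat\beta_3=\frac{13\sqrt\mu}{16},\quad \hat\beta_4=\frac{4\mu^2\sqrt s+3L\sqrt\mu\sqrt{\mu_s}}{8L^2},\quad \hat\beta_5=\sqrt{\mu_s}\Big(\frac{5\sqrt\mu L}{2}-\frac{\mu^{3/2}}{2}\Big),$$ and, with $0<\alpha<1$, define $$a_2^*=\alpha\min\Big\{\frac{-\hat\beta_1+\sqrt{\hat\beta_1^2+4\hat\beta_5\hat\beta_3}}{2\hat\beta_5},\ \frac{\hat\beta_4}{\hat\beta_2}\Big\}.$$ Then, for $0\le a\le a_2^*$ and $\#\in\{\mathrm{ET},\mathrm{ST}\}$, the derivative-based Displaced-Gradient Algorithm, i.e. $p_{k+1}=p_k+\Delta_kX^a_{\mathrm{hb}}(p_k)$ with $\Delta_k=\mathrm{step}^{\mathrm d}_{\#}(p_k;a)$, has the following properties: (i) the stepsize $\Delta_k$ is uniformly lower bounded by the positive constant $$\mathrm{MIET}(a)=-\nu+\sqrt{\nu^2+\eta},$$ where $\eta=\min\{\eta_1,\eta_2\}$, $\nu=\max\{\nu_1,\nu_2\}$ and $$\eta_1=\frac{8a\sqrt{\mu_s}\big(a(\mu-5L)-\frac{2L}{\sqrt\mu}-3\big)+13}{2\sqrt{\mu_s}L(3a^2\sqrt{\mu_s}L+1)+8\mu},\qquad \eta_2=-\frac{3\sqrt{\mu_s}\sqrt\mu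 L(4aL-1)-4\mu^2\sqrt s}{3\mu_s\sqrt\mu L^2},$$ $$\nu_1=\frac{\mu(2a^3\sqrt{\mu_s}L^2+a\sqrt{\mu_s}+16)+8\sqrt{\mu_s}L(2a^2\sqrt{\mu_s}L+1)}{2\sqrt\mu\big(\sqrt{\mu_s}L(3a^2\sqrt{\mu_s}L+1)+4\mu\big)}+\frac{\sqrt{\mu_s}(aL(8aL+1)+4)}{\sqrt{\mu_s}L(3a^2\sqrt{\mu_s}L+1)+4\mu},$$ $$\nu_2=\frac{a\mu+8\sqrt{\mu_s}+8\sqrt\mu}{3\sqrt{\mu_s}\sqrt\mu};$$ (ii) $\frac{d}{dt}V(p_k+tX^a_{\mathrm{hb}}(p_k))\le-\frac{\sqrt\mu}{4}V(p_k+tX^a_{\mathrm{hb}}(p_k))$ for all $t\in[0,\Delta_k]$ and all $k\in\{0\}\cup\mathbb{N}$. As a consequence, $f(x_{k+1})-f(x_* )=\mathcal O\big(e^{-\frac{\sqrt\mu}{4}\sum_{i=0}^k\Delta_i}\big)$.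
   Context: Let $\mu,L,s>0$, and let $f:\mathbb{R}^n\to\mathbb{R}$ be continuously differentiable, $\mu$-strongly convex (i.e. $f(y)-f(x)\ge\langle\nabla f(x),y-x\rangle+\frac{\mu}{2}\|x-y\|^2$ for all $x,y$), with $L$-Lipschitz gradient; $x_*$ is its unique minimizer. Norms are Euclidean. Notation: $\sqrt{\mu_s}=1+\sqrt{\mu s}$, so $\mu_s=(1+\sqrt{\mu s})^2$. For $a\ge0$, $$X^a_{\mathrm{hb}}(x,v)=\begin{bmatrix} v\\ -2\sqrt{\mu}\,v-\sqrt{\mu_s}\,\nabla f(x+av)\end{bmatrix},$$ $$V(x,v)=\sqrt{\mu_s}\,(f(x)-f(x_* ))+\tfrac14\|v\|^2+\tfrac14\|v+2\sqrt{\mu}(x-x_* )\|^2 .$$ For $\hat p=[\hat x,\hat v]^T$ write $\hat g=\nabla f(\hat x+a\hat v)$ and define $$b^{\mathrm d}_{\mathrm{ET}}(\hat p,t;a)=A_{\mathrm{ET}}(\hat p,t;a)+B_{\mathrm{ET}}(\hat p,t;a)+C_{\mathrm{ET}}(\hat p;a),$$ $$b^{\mathrm d}_{\mathrm{ST}}(\hat p,t;a)=B^q_{\mathrm{ST}}(\hat p;a)t^2+(A_{\mathrm{ST}}(\hat p;a)+B^l_{\mathrm{ST}}(\hat p;a))t+C_{\mathrm{ST}}(\hat p;a),$$ where $$A_{\mathrm{ET}}(\hat p,t;a)=2\mu t\|\hat v\|^2+\sqrt{\mu_s}\big(\langle\nabla f(\hat x+t\hat v)-\nabla f(\hat x),\hat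 v\rangle+2t\sqrt\mu\langle\hat g,\hat v\rangle+t\sqrt{\mu_s}\|\hat g\|^2\big),$$ $$B_{\mathrm{ET}}(\hat p,t;a)=\frac{\sqrt\mu t^2}{16}\|2\sqrt\mu\hat v+\sqrt{\mu_s}\hat g\|^2-\frac{t\mu}{4}\|\hat v\|^2+\frac{\sqrt\mu\sqrt{\mu_s}}{4}\Big(f(\hat x+t\hat v)-f(\hat x)-t\langle\hat v,\hat g\rangle+\frac{t^2\sqrt{\mu_s}}{4}\|\hat g\|^2-\frac{t\sqrt\mu}{L}\|\hat g\|^2+t\sqrt\mu\langle a\hat v,\hat g\rangle\Big),$$ $$C_{\mathrm{ET}}(\hat p;a)=-\frac{13\sqrt\mu}{16}\|\hat v\|^2-\frac{\mu^2\sqrt s}{2}\frac{\|\nabla f(\hat x)\|^2}{L^2}+\sqrt{\mu_s}\Big(-\frac{3\sqrt\mu}{8L}\|\nabla f(\hat x)\|^2+\sqrt\mu(f(\hat x)-f(\hat x+a\hat v))+\sqrt\mu\|\nabla f(\hat x)\|\|a\hat v\|-\frac{\mu^{3/2}}{2}\|a\hat v\|^2-\langle\hat g-\nabla f(\hat x),\hat v\rangle+\sqrt\mu\langle\hat g,a\hat v\rangle\Big),$$ $$A_{\mathrm{ST}}(\hat p;a)=2\mu\|\hat v\|^2+\sqrt{\mu_s}\big(L\|\hat v\|^2+2\sqrt\mu\langle\hat g,\hat v\rangle+\sqrt{\mu_s}\|\hat g\|^2\big),$$ $$B^l_{\mathrm{ST}}(\hat p;a)=\frac{\sqrt\mu}{4}\Big(-\sqrt\mu\|\hat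 v\|^2+\sqrt{\mu_s}\big(\langle\nabla f(\hat x)-\hat g,\hat v\rangle-\frac{\sqrt\mu}{L}\|\hat g\|^2+\sqrt\mu\langle a\hat v,\hat g\rangle\big)\Big),$$ $$B^q_{\mathrm{ST}}(\hat p;a)=\frac{\sqrt\mu}{16}\|2\sqrt\mu\hat v+\sqrt{\mu_s}\hat g\|^2+\frac{\sqrt\mu\sqrt{\mu_s}}{4}\Big(\frac L2\|\hat v\|^2+\frac{\sqrt{\mu_s}}{4}\|\hat g\|^2\Big),$$ $$C_{\mathrm{ST}}(\hat p;a)=C_{\mathrm{ET}}(\hat p;a).$$ The stepsize is $\mathrm{step}^{\mathrm d}_{\#}(\hat p;a)=\min\{t>0 : b^{\mathrm d}_{\#}(\hat p,t;a)=0\}$. Displaced-Gradient Algorithm (derivative-based): given an initial point $p_0=[x_0,v_0]^T$, a tolerance $\epsilon>0$, and $a\ge0$, start with $k=0$; while $\|\nabla f(x_k)\|\ge\epsilon$, compute $\Delta_k=\mathrm{step}^{\mathrm d}_{\#}(p_k;a)$, set $p_{k+1}=[x_{k+1},v_{k+1}]^T=p_k+\Delta_kX^a_{\mathrm{hb}}(p_k)$, and increase $k$ by one. Assertions indexed by $k$ refer to the iterations actually performed. The $\mathcal O(\cdot)$ means an upper bound by a constant independent of $k$ times the given expression. *)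

theory Defs
  imports "HOL-Analysis.Analysis"
begin

text \<open>
  Points \<open>p = (x, v)\<close> of the phase space are pairs. Throughout, \<open>g\<close> stands for the gradient of
  the objective \<open>f\<close>, and \<open>rt_mu_s mu s\<close> is the quantity written \<open>sqrt (mu_s)\<close> on paper; it is not
  the square root of \<open>mu * s\<close>.
\<close>

definition rt_mu_s :: "real \<Rightarrow> real \<Rightarrow> real" where
  "rt_mu_s \<mu> s = 1 + sqrt (\<mu> * s)"

definition mu_s :: "real \<Rightarrow> real \<Rightarrow> real" where
  "mu_s \<mu> s = (1 + sqrt (\<mu> * s))\<^sup>2"

definition X_hb ::
  "('a::real_inner \<Rightarrow> 'a) \<Rightarrow> real \<Rightarrow> real \<Rightarrow> real \<Rightarrow> 'a \<times> 'a \<Rightarrow> 'a \<times> 'a" where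
  "X_hb g \<mu> s a p = (let x = fst p; v = snd p in
     (v, - (2 * sqrt \<mu>) *\<^sub>R v - rt_mu_s \<mu> s *\<^sub>R g (x + a *\<^sub>R v)))"

definition V_lyap ::
  "('a::real_inner \<Rightarrow> real) \<Rightarrow> 'a \<Rightarrow> real \<Rightarrow> real \<Rightarrow> 'a \<times> 'a \<Rightarrow> real" where
  "V_lyap f xstar \<mu> s p = (let x = fst p; v = snd p in
     rt_mu_s \<mu> s * (f x - f xstar) + 1/4 * (norm v)\<^sup>2
       + 1/4 * (norm (v + (2 * sqrt \<mu>) *\<^sub>R (x - xstar)))\<^sup>2)"

definition A_ET ::
  "('a::real_inner \<Rightarrow> 'a) \<Rightarrow> real \<Rightarrow> real \<Rightarrow> real \<Rightarrow> 'a \<times> 'a \<Rightarrow> real \<Rightarrow> real" where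
  "A_ET g \<mu> s a p t = (let x = fst p; v = snd p; gh = g (x + a *\<^sub>R v); r = rt_mu_s \<mu> s in
     2 * \<mu> * t * (norm v)\<^sup>2
     + r * ((g (x + t *\<^sub>R v) - g x) \<bullet> v + 2 * t * sqrt \<mu> * (gh \<bullet> v) + t * r * (norm gh)\<^sup>2))"

definition B_ET ::
  "('a::real_inner \<Rightarrow> real) \<Rightarrow> ('a \<Rightarrow> 'a) \<Rightarrow> real \<Rightarrow> real \<Rightarrow> real \<Rightarrow> real \<Rightarrow> 'a \<times> 'a \<Rightarrow> real \<Rightarrow> real"
where
  "B_ET f g \<mu> L s a p t = (let x = fst p; v = snd p; gh = g (x + a *\<^sub>R v); r = rt_mu_s \<mu> s in
     sqrt \<mu> * t\<^sup>2 / 16 * (norm ((2 * sqrt \<mu>) *\<^sub>R v + r *\<^sub>R gh))\<^sup>2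
     - t * \<mu> / 4 * (norm v)\<^sup>2
     + sqrt \<mu> * r / 4 *
       (f (x + t *\<^sub>R v) - f x - t * (v \<bullet> gh) + t\<^sup>2 * r / 4 * (norm gh)\<^sup>2
        - t * sqrt \<mu> / L * (norm gh)\<^sup>2 + t * sqrt \<mu> * ((a *\<^sub>R v) \<bullet> gh)))"

definition C_ET ::
  "('a::real_inner \<Rightarrow> real) \<Rightarrow> ('a \<Rightarrow> 'a) \<Rightarrow> real \<Rightarrow> real \<Rightarrow> real \<Rightarrow> real \<Rightarrow> 'a \<times> 'a \<Rightarrow> real"
where
  "C_ET f g \<mu> L s a p = (let x = fst p; v = snd p; gh = g (x + a *\<^sub>R v); r = rt_mu_s \<mu> s in
     - (13 * sqrt \<mu> / 16) * (norm v)\<^sup>2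
     - \<mu>\<^sup>2 * sqrt s / 2 * ((norm (g x))\<^sup>2 / L\<^sup>2)
     + r * (- (3 * sqrt \<mu> / (8 * L)) * (norm (g x))\<^sup>2
            + sqrt \<mu> * (f x - f (x + a *\<^sub>R v))
            + sqrt \<mu> * norm (g x) * norm (a *\<^sub>R v)
            - \<mu> powr (3/2) / 2 * (norm (a *\<^sub>R v))\<^sup>2
            - (gh - g x) \<bullet> v
            + sqrt \<mu> * (gh \<bullet> (a *\<^sub>R v))))"

definition b_ET ::
  "('a::real_inner \<Rightarrow> real) \<Rightarrow> ('a \<Rightarrow> 'a) \<Rightarrow> real \<Rightarrow> real \<Rightarrow> real \<Rightarrow> real \<Rightarrow> 'a \<times> 'a \<Rightarrow> real \<Rightarrow> real"
where
  "b_ET f g \<mu> L s a p t = A_ET g \<mu> s a p t + B_ET f g \<mu> L s a p t + C_ET f g \<mu> L s a p"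

definition A_ST ::
  "('a::real_inner \<Rightarrow> 'a) \<Rightarrow> real \<Rightarrow> real \<Rightarrow> real \<Rightarrow> real \<Rightarrow> 'a \<times> 'a \<Rightarrow> real" where
  "A_ST g \<mu> L s a p = (let x = fst p; v = snd p; gh = g (x + a *\<^sub>R v); r = rt_mu_s \<mu> s in
     2 * \<mu> * (norm v)\<^sup>2
     + r * (L * (norm v)\<^sup>2 + 2 * sqrt \<mu> * (gh \<bullet> v) + r * (norm gh)\<^sup>2))"

definition Bl_ST ::
  "('a::real_inner \<Rightarrow> 'a) \<Rightarrow> real \<Rightarrow> real \<Rightarrow> real \<Rightarrow> real \<Rightarrow> 'a \<times> 'a \<Rightarrow> real" where
  "Bl_ST g \<mu> L s a p = (let x = fst p; v = snd p; gh = g (x + a *\<^sub>R v); r = rt_mu_s \<mu> s in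
     sqrt \<mu> / 4 *
       (- sqrt \<mu> * (norm v)\<^sup>2
        + r * ((g x - gh) \<bullet> v - sqrt \<mu> / L * (norm gh)\<^sup>2 + sqrt \<mu> * ((a *\<^sub>R v) \<bullet> gh))))"

definition Bq_ST ::
  "('a::real_inner \<Rightarrow> 'a) \<Rightarrow> real \<Rightarrow> real \<Rightarrow> real \<Rightarrow> real \<Rightarrow> 'a \<times> 'a \<Rightarrow> real" where
  "Bq_ST g \<mu> L s a p = (let x = fst p; v = snd p; gh = g (x + a *\<^sub>R v); r = rt_mu_s \<mu> s in
     sqrt \<mu> / 16 * (norm ((2 * sqrt \<mu>) *\<^sub>R v + r *\<^sub>R gh))\<^sup>2
     + sqrt \<mu> * r / 4 * (L / 2 * (norm v)\<^sup>2 + r / 4 * (norm gh)\<^sup>2))"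

definition C_ST ::
  "('a::real_inner \<Rightarrow> real) \<Rightarrow> ('a \<Rightarrow> 'a) \<Rightarrow> real \<Rightarrow> real \<Rightarrow> real \<Rightarrow> real \<Rightarrow> 'a \<times> 'a \<Rightarrow> real"
where
  "C_ST f g \<mu> L s a p = C_ET f g \<mu> L s a p"

definition b_ST ::
  "('a::real_inner \<Rightarrow> real) \<Rightarrow> ('a \<Rightarrow> 'a) \<Rightarrow> real \<Rightarrow> real \<Rightarrow> real \<Rightarrow> real \<Rightarrow> 'a \<times> 'a \<Rightarrow> real \<Rightarrow> real"
where
  "b_ST f g \<mu> L s a p t =
     Bq_ST g \<mu> L s a p * t\<^sup>2 + (A_ST g \<mu> L s a p + Bl_ST g \<mu> L s a p) * t + C_ST f g \<mu> L s a p"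

datatype trigger = ET | ST

fun b_trig ::
  "trigger \<Rightarrow> ('a::real_inner \<Rightarrow> real) \<Rightarrow> ('a \<Rightarrow> 'a) \<Rightarrow> real \<Rightarrow> real \<Rightarrow> real \<Rightarrow> real
     \<Rightarrow> 'a \<times> 'a \<Rightarrow> real \<Rightarrow> real"
where
  "b_trig ET f g \<mu> L s a p t = b_ET f g \<mu> L s a p t"
| "b_trig ST f g \<mu> L s a p t = b_ST f g \<mu> L s a p t"

definition is_step ::
  "trigger \<Rightarrow> ('a::real_inner \<Rightarrow> real) \<Rightarrow> ('a \<Rightarrow> 'a) \<Rightarrow> real \<Rightarrow> real \<Rightarrow> real \<Rightarrow> real
     \<Rightarrow> 'a \<times> 'a \<Rightarrow> real \<Rightarrow> bool"
where
  "is_step trig f g \<mu> L s a p d \<longleftrightarrow>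
     0 < d \<and> b_trig trig f g \<mu> L s a p d = 0 \<and>
     (\<forall>t>0. b_trig trig f g \<mu> L s a p t = 0 \<longrightarrow> d \<le> t)"

text \<open>
  \<open>LEAST\<close> over the reals is an unspecified value when there is no minimum; \<open>is_step\<close> says
  that the minimum exists and equals the given number.
\<close>

definition step ::
  "trigger \<Rightarrow> ('a::real_inner \<Rightarrow> real) \<Rightarrow> ('a \<Rightarrow> 'a) \<Rightarrow> real \<Rightarrow> real \<Rightarrow> real \<Rightarrow> real
     \<Rightarrow> 'a \<times> 'a \<Rightarrow> real"
where
  "step trig f g \<mu> L s a p = (LEAST t. 0 < t \<and> b_trig trig f g \<mu> L s a p t = 0)"

primrec dg_iter ::
  "trigger \<Rightarrow> ('a::real_inner \<Rightarrow> real) \<Rightarrow> ('a \<Rightarrow> 'a) \<Rightarrow> real \<Rightarrow> real \<Rightarrow> real \<Rightarrow> real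
     \<Rightarrow> 'a \<times> 'a \<Rightarrow> nat \<Rightarrow> 'a \<times> 'a"
where
  "dg_iter trig f g \<mu> L s a p0 0 = p0"
| "dg_iter trig f g \<mu> L s a p0 (Suc k) =
     (let p = dg_iter trig f g \<mu> L s a p0 k
      in p + step trig f g \<mu> L s a p *\<^sub>R X_hb g \<mu> s a p)"

text \<open>
  The tolerance only decides when the loop stops, so it does not enter \<open>dg_iter\<close>. The loop body
  is executed for the index \<open>k\<close> iff the loop test has succeeded for all indices up to \<open>k\<close>.
\<close>

definition dg_performed ::
  "trigger \<Rightarrow> ('a::real_inner \<Rightarrow> real) \<Rightarrow> ('a \<Rightarrow> 'a) \<Rightarrow> real \<Rightarrow> real \<Rightarrow> real \<Rightarrow> real
     \<Rightarrow> 'a \<times> 'a \<Rightarrow> real \<Rightarrow> nat \<Rightarrow> bool"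
where
  "dg_performed trig f g \<mu> L s a p0 \<epsilon> k \<longleftrightarrow>
     (\<forall>i\<le>k. norm (g (fst (dg_iter trig f g \<mu> L s a p0 i))) \<ge> \<epsilon>)"

definition beta1 :: "real \<Rightarrow> real \<Rightarrow> real \<Rightarrow> real" where
  "beta1 \<mu> L s = rt_mu_s \<mu> s * (3 * sqrt \<mu> / 2 + L)"

definition beta2 :: "real \<Rightarrow> real \<Rightarrow> real" where
  "beta2 \<mu> s = 3/2 * sqrt \<mu> * rt_mu_s \<mu> s"

definition beta3 :: "real \<Rightarrow> real" where
  "beta3 \<mu> = 13 * sqrt \<mu> / 16"

definition beta4 :: "real \<Rightarrow> real \<Rightarrow> real \<Rightarrow> real" where
  "beta4 \<mu> L s = (4 * \<mu>\<^sup>2 * sqrt s + 3 * L * sqrt \<mu> * rt_mu_s \<mu> s) / (8 * L\<^sup>2)"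

definition beta5 :: "real \<Rightarrow> real \<Rightarrow> real \<Rightarrow> real" where
  "beta5 \<mu> L s = rt_mu_s \<mu> s * (5 * sqrt \<mu> * L / 2 - \<mu> powr (3/2) / 2)"

definition a2_star :: "real \<Rightarrow> real \<Rightarrow> real \<Rightarrow> real \<Rightarrow> real" where
  "a2_star \<alpha> \<mu> L s = \<alpha> * min
     ((- beta1 \<mu> L s + sqrt ((beta1 \<mu> L s)\<^sup>2 + 4 * beta5 \<mu> L s * beta3 \<mu>)) / (2 * beta5 \<mu> L s))
     (beta4 \<mu> L s / beta2 \<mu> s)"

definition eta1 :: "real \<Rightarrow> real \<Rightarrow> real \<Rightarrow> real \<Rightarrow> real" where
  "eta1 \<mu> L s a = (let r = rt_mu_s \<mu> s in
     (8 * a * r * (a * (\<mu> - 5 * L) - 2 * L / sqrt \<mu> - 3) + 13)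
     / (2 * r * L * (3 * a\<^sup>2 * r * L + 1) + 8 * \<mu>))"

definition eta2 :: "real \<Rightarrow> real \<Rightarrow> real \<Rightarrow> real \<Rightarrow> real" where
  "eta2 \<mu> L s a = (let r = rt_mu_s \<mu> s in
     - ((3 * r * sqrt \<mu> * L * (4 * a * L - 1) - 4 * \<mu>\<^sup>2 * sqrt s)
        / (3 * mu_s \<mu> s * sqrt \<mu> * L\<^sup>2)))"

definition nu1 :: "real \<Rightarrow> real \<Rightarrow> real \<Rightarrow> real \<Rightarrow> real" where
  "nu1 \<mu> L s a = (let r = rt_mu_s \<mu> s in
     (\<mu> * (2 * a^3 * r * L\<^sup>2 + a * r + 16) + 8 * r * L * (2 * a\<^sup>2 * r * L + 1))
       / (2 * sqrt \<mu> * (r * L * (3 * a\<^sup>2 * r * L + 1) + 4 * \<mu>))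
     + r * (a * L * (8 * a * L + 1) + 4)
       / (r * L * (3 * a\<^sup>2 * r * L + 1) + 4 * \<mu>))"

definition nu2 :: "real \<Rightarrow> real \<Rightarrow> real \<Rightarrow> real" where
  "nu2 \<mu> s a = (let r = rt_mu_s \<mu> s in
     (a * \<mu> + 8 * r + 8 * sqrt \<mu>) / (3 * r * sqrt \<mu>))"

definition MIET :: "real \<Rightarrow> real \<Rightarrow> real \<Rightarrow> real \<Rightarrow> real" where
  "MIET \<mu> L s a =
     (let \<eta> = min (eta1 \<mu> L s a) (eta2 \<mu> L s a);
          \<nu> = max (nu1 \<mu> L s a) (nu2 \<mu> s a)
      in - \<nu> + sqrt (\<nu>\<^sup>2 + \<eta>))"

end

theory Submission
  imports Defs
begin

text \<open>
  Along a forward Euler segment of \<open>X_hb\<close>, the quantity \<open>dV/dt + sqrt mu / 4 * V\<close> is bounded by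
  \<open>b_ET\<close>, and \<open>b_ET\<close> by \<open>b_ST\<close>. So \<open>V\<close> decays at the required rate as long as the trigger
  function is nonpositive, i.e. up to its first positive zero. Since \<open>|gh|\<^sup>2 \<le> 2 a\<^sup>2 L\<^sup>2 |v|\<^sup>2 + 2 |g x|\<^sup>2\<close>,
  \<open>b_ST\<close> is bounded by a combination of \<open>|v|\<^sup>2\<close> and \<open>|g x|\<^sup>2\<close> whose coefficients are positive multiples
  of \<open>t\<^sup>2 + 2 nu_i t - eta_i\<close>; both are negative for \<open>t\<close> below \<open>MIET\<close>. Strong convexity makes
  \<open>b_ET\<close> grow quadratically in \<open>t\<close>, so a positive zero exists.
\<close>

section \<open>Strongly convex functions with Lipschitz gradient\<close>

locale strongly_convex_smooth =
  fixes f :: "'a::real_inner \<Rightarrow> real" and g :: "'a \<Rightarrow> 'a" and \<mu> L :: real and xstar :: 'a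
  assumes mu_pos: "\<mu> > 0" and L_pos: "L > 0"
    and gradient: "GDERIV f x :> g x"
    and strongly_convex: "f y - f x \<ge> g x \<bullet> (y - x) + \<mu> / 2 * (norm (x - y))\<^sup>2"
    and lipschitz: "L-lipschitz_on UNIV g"
    and minimizer: "f xstar \<le> f x"
begin

lemma norm_gradient_diff_le: "norm (g x - g y) \<le> L * norm (x - y)"
  using lipschitz_onD[OF lipschitz, of x y] by (simp add: dist_norm)

lemma gradient_diff_inner_le: "(g (x + t *\<^sub>R v) - g x) \<bullet> v \<le> L * t * (norm v)\<^sup>2" if "t \<ge> 0"
proof -
  have "(g (x + t *\<^sub>R v) - g x) \<bullet> v \<le> norm (g (x + t *\<^sub>R v) - g x) * norm v"
    by (rule norm_cauchy_schwarz)
  also have "\<dots> \<le> (L * norm (t *\<^sub>R v)) * norm v"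
    using norm_gradient_diff_le[of "x + t *\<^sub>R v" x] by (intro mult_right_mono) auto
  finally show ?thesis using that by (simp add: power2_eq_square algebra_simps)
qed

lemma gradient_strongly_monotone: "(g y - g x) \<bullet> (y - x) \<ge> \<mu> * (norm (y - x))\<^sup>2"
  using strongly_convex[of x y] strongly_convex[of y x]
  by (simp add: norm_minus_commute inner_diff algebra_simps)

lemma has_real_derivative_along_line:
  "((\<lambda>t. f (x + t *\<^sub>R v)) has_real_derivative g (x + t *\<^sub>R v) \<bullet> v) (at t)"
proof -
  have "(f has_derivative (\<lambda>h. h \<bullet> g (x + t *\<^sub>R v))) (at (x + t *\<^sub>R v))"
    using gradient[of "x + t *\<^sub>R v"] by (simp add: gderiv_def)
  moreover have "((\<lambda>t. x + t *\<^sub>R v) has_derivative (\<lambda>h. h *\<^sub>R v)) (at t)"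
    by (auto intro!: derivative_eq_intros)
  ultimately have "((\<lambda>t. f (x + t *\<^sub>R v)) has_derivative (\<lambda>h. (h *\<^sub>R v) \<bullet> g (x + t *\<^sub>R v))) (at t)"
    by (rule has_derivative_compose[rotated])
  moreover have "(\<lambda>h. (h *\<^sub>R v) \<bullet> g (x + t *\<^sub>R v)) = (*) (g (x + t *\<^sub>R v) \<bullet> v)"
    by (auto simp: inner_commute)
  ultimately show ?thesis by (simp add: has_field_derivative_def)
qed

lemma descent: "f (x + t *\<^sub>R v) \<le> f x + t * (g x \<bullet> v) + L / 2 * t\<^sup>2 * (norm v)\<^sup>2" if "t \<ge> 0"
proof -
  \<comment> \<open>\<open>f\<close> along the ray minus its quadratic upper model; the Lipschitz
    bound makes the derivative nonpositive for \<open>\<tau> \<ge> 0\<close>.\<close>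
  define \<phi> where "\<phi> = (\<lambda>t. f (x + t *\<^sub>R v) - t * (g x \<bullet> v) - L / 2 * t\<^sup>2 * (norm v)\<^sup>2)"
  have der: "(\<phi> has_real_derivative
      (g (x + \<tau> *\<^sub>R v) \<bullet> v - g x \<bullet> v - L * \<tau> * (norm v)\<^sup>2)) (at \<tau>)" for \<tau>
    unfolding \<phi>_def
    by (auto intro!: derivative_eq_intros has_real_derivative_along_line)
  have "\<phi> t \<le> \<phi> 0"
  proof (rule DERIV_nonpos_imp_nonincreasing[OF that])
    fix \<tau> :: real assume "0 \<le> \<tau>"
    then show "\<exists>y. (\<phi> has_real_derivative y) (at \<tau>) \<and> y \<le> 0"
      using der[of \<tau>] gradient_diff_inner_le[of \<tau> x v] by (auto simp: inner_diff_left)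
  qed
  then show ?thesis by (simp add: \<phi>_def)
qed

text \<open>The gradient step of length \<open>1 / L\<close> minimizes the quadratic upper model of
  \<open>descent\<close>, and its endpoint cannot lie below the minimum value.\<close>

lemma gap_ge_gradient: "f x - f xstar \<ge> (norm (g x))\<^sup>2 / (2 * L)"
proof -
  have "f xstar \<le> f (x + (1 / L) *\<^sub>R (- g x))" by (rule minimizer)
  also have "\<dots> \<le> f x + 1 / L * (g x \<bullet> (- g x)) + L / 2 * (1 / L)\<^sup>2 * (norm (- g x))\<^sup>2"
    using L_pos by (intro descent) simp
  also have "\<dots> = f x - (norm (g x))\<^sup>2 / (2 * L)"
    using L_pos by (simp add: power2_norm_eq_inner field_simps power2_eq_square[of L])
  finally show ?thesis by simp
qed

lemma gradient_minimizer: "g xstar = 0"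
  using gap_ge_gradient[of xstar] L_pos by (simp add: divide_le_0_iff)

lemma norm_gradient_le: "norm (g x) \<le> L * norm (x - xstar)"
  using norm_gradient_diff_le[of x xstar] by (simp add: gradient_minimizer)

lemma norm_gradient_ge: "\<mu> * norm (x - xstar) \<le> norm (g x)"
proof (cases "x = xstar")
  case False
  have "\<mu> * (norm (x - xstar))\<^sup>2 \<le> g x \<bullet> (x - xstar)"
    using gradient_strongly_monotone[of x xstar] by (simp add: gradient_minimizer)
  also have "\<dots> \<le> norm (g x) * norm (x - xstar)" by (rule norm_cauchy_schwarz)
  finally show ?thesis using False by (simp add: power2_eq_square)
qed simp

text \<open>Both summands of \<open>|g y|\<^sup>2 / L\<close> come from a gradient step of length \<open>1 / L\<close>: one taken from
  \<open>y\<close>, the other from \<open>xstar\<close> for the function \<open>f - g y \<bullet> _\<close>, which is minimal at \<open>y\<close>.\<close>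

lemma cocoercive_minimizer: "g y \<bullet> (y - xstar) \<ge> (norm (g y))\<^sup>2 / L"
proof -
  let ?z = "xstar + (1 / L) *\<^sub>R g y"
  have "g y \<bullet> (?z - y) \<le> f ?z - f y"
    using strongly_convex[of y ?z] mu_pos by (smt (verit) mult_nonneg_nonneg zero_le_power2 half_gt_zero)
  moreover have "f ?z \<le> f xstar + (norm (g y))\<^sup>2 / (2 * L)"
    using descent[of "1 / L" xstar "g y"] L_pos
    by (simp add: gradient_minimizer power2_eq_square[of L] power_divide)
  moreover have "g y \<bullet> (?z - y) = (norm (g y))\<^sup>2 / L - g y \<bullet> (y - xstar)"
    by (simp add: inner_diff_right inner_add_right power2_norm_eq_inner)
  ultimately show ?thesis using gap_ge_gradient[of y] by simp
qed

lemma gradient_sq_bound: "(norm (g (x + a *\<^sub>R v)))\<^sup>2 \<le> 2 * a\<^sup>2 * L\<^sup>2 * (norm v)\<^sup>2 + 2 * (norm (g x))\<^sup>2"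
proof -
  have "norm (g (x + a *\<^sub>R v) - g x) \<le> L * norm (a *\<^sub>R v)"
    using norm_gradient_diff_le[of "x + a *\<^sub>R v" x] by simp
  then have d: "(norm (g (x + a *\<^sub>R v) - g x))\<^sup>2 \<le> a\<^sup>2 * L\<^sup>2 * (norm v)\<^sup>2"
    using power_mono[of "norm (g (x + a *\<^sub>R v) - g x)" "L * norm (a *\<^sub>R v)" 2]
    by (simp add: power_mult_distrib algebra_simps)
  have "norm (g (x + a *\<^sub>R v)) \<le> norm (g (x + a *\<^sub>R v) - g x) + norm (g x)"
    using norm_triangle_ineq[of "g (x + a *\<^sub>R v) - g x" "g x"] by simp
  then have "(norm (g (x + a *\<^sub>R v)))\<^sup>2 \<le> (norm (g (x + a *\<^sub>R v) - g x) + norm (g x))\<^sup>2"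
    by (intro power_mono) auto
  also have "\<dots> \<le> 2 * (norm (g (x + a *\<^sub>R v) - g x))\<^sup>2 + 2 * (norm (g x))\<^sup>2"
    using zero_le_power2[of "norm (g (x + a *\<^sub>R v) - g x) - norm (g x)"]
    by (simp add: power2_eq_square algebra_simps)
  finally show ?thesis using d by simp
qed

end

section \<open>Elementary facts on the constants and on norms\<close>

lemma mu_powr_three_halves: "\<mu> powr (3/2) = sqrt \<mu> * \<mu>" if "\<mu> > 0" for \<mu> :: real
proof -
  have "\<mu> powr (3/2) = \<mu> powr (1/2 + 1)" by simp
  also have "\<dots> = sqrt \<mu> * \<mu>"
    unfolding powr_add using that by (simp add: powr_half_sqrt)
  finally show ?thesis .
qed

lemma rt_mu_s_ge_1: "rt_mu_s \<mu> s \<ge> 1" if "\<mu> > 0" "s > 0"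
  using that by (simp add: rt_mu_s_def)

lemma two_inner_le: "2 * (u \<bullet> v) \<le> (norm u)\<^sup>2 + (norm v)\<^sup>2" for u v :: "'a::real_inner"
  using zero_le_power2[of "norm (u - v)"]
  by (simp add: power2_norm_eq_inner inner_diff inner_commute)

lemma norm_sq_line_has_real_derivative:
  "((\<lambda>t. (norm (u + t *\<^sub>R w))\<^sup>2) has_real_derivative 2 * ((u + t *\<^sub>R w) \<bullet> w)) (at t)"
  for u w :: "'a::real_inner"
proof -
  have "(norm (u + t *\<^sub>R w))\<^sup>2 = u \<bullet> u + 2 * t * (u \<bullet> w) + t\<^sup>2 * (w \<bullet> w)" for t
    unfolding power2_norm_eq_inner
    by (simp add: inner_add inner_commute power2_eq_square algebra_simps)
  then show ?thesis
    by (auto intro!: derivative_eq_intros simp: inner_add_left)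
qed

section \<open>Decay of the Lyapunov function along a segment\<close>

context strongly_convex_smooth
begin

text \<open>The velocity part of \<open>X_hb\<close> plus \<open>2 * sqrt \<mu>\<close> times its position part is \<open>- r *\<^sub>R gh\<close>, so
  the last summand of the Lyapunov function only moves in the direction of \<open>gh\<close>.\<close>

lemma V_lyap_along:
  "V_lyap f xstar \<mu> s ((x, v) + t *\<^sub>R X_hb g \<mu> s a (x, v)) =
     (let r = rt_mu_s \<mu> s; gh = g (x + a *\<^sub>R v); w = - (2 * sqrt \<mu>) *\<^sub>R v - r *\<^sub>R gh in
      r * (f (x + t *\<^sub>R v) - f xstar) + 1/4 * (norm (v + t *\<^sub>R w))\<^sup>2
        + 1/4 * (norm (v + (2 * sqrt \<mu>) *\<^sub>R (x - xstar) - (t * r) *\<^sub>R gh))\<^sup>2)"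
  unfolding V_lyap_def X_hb_def Let_def by (simp add: algebra_simps)

lemma V_lyap_has_real_derivative:
  fixes x v :: 'a and s a t :: real
  defines "r \<equiv> rt_mu_s \<mu> s" and "gh \<equiv> g (x + a *\<^sub>R v)"
  defines "w \<equiv> - (2 * sqrt \<mu>) *\<^sub>R v - r *\<^sub>R gh"
  shows "((\<lambda>\<tau>. V_lyap f xstar \<mu> s ((x, v) + \<tau> *\<^sub>R X_hb g \<mu> s a (x, v))) has_real_derivative
     (r * (g (x + t *\<^sub>R v) \<bullet> v) + 1/2 * ((v + t *\<^sub>R w) \<bullet> w)
       - r / 2 * (gh \<bullet> (v + (2 * sqrt \<mu>) *\<^sub>R (x - xstar) - (t * r) *\<^sub>R gh)))) (at t)"
  unfolding V_lyap_along Let_def r_def[symmetric] gh_def[symmetric] w_def[symmetric]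
proof -
  define y where "y = v + (2 * sqrt \<mu>) *\<^sub>R (x - xstar)"
  have ny: "((\<lambda>\<tau>. (norm (y - (\<tau> * r) *\<^sub>R gh))\<^sup>2) has_real_derivative
      - (2 * (r * (gh \<bullet> (y - (t * r) *\<^sub>R gh))))) (at t)"
    using norm_sq_line_has_real_derivative[of y "- r *\<^sub>R gh" t] by (simp add: inner_commute)
  show "((\<lambda>\<tau>. r * (f (x + \<tau> *\<^sub>R v) - f xstar) + 1/4 * (norm (v + \<tau> *\<^sub>R w))\<^sup>2
      + 1/4 * (norm (y - (\<tau> * r) *\<^sub>R gh))\<^sup>2) has_real_derivative
     (r * (g (x + t *\<^sub>R v) \<bullet> v) + 1/2 * ((v + t *\<^sub>R w) \<bullet> w)
       - r / 2 * (gh \<bullet> (y - (t * r) *\<^sub>R gh)))) (at t)"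
    by (rule DERIV_cong[OF DERIV_add[OF DERIV_add[OF DERIV_cmult[OF DERIV_diff[OF
              has_real_derivative_along_line DERIV_const]]
              DERIV_cmult[OF norm_sq_line_has_real_derivative]] DERIV_cmult[OF ny]]]) simp
qed

text \<open>The part of the decay estimate that does not depend on the time: strong convexity
  at \<open>x + a *\<^sub>R v\<close> trades the inner product with \<open>x - xstar\<close> for function values.\<close>

lemma C_ET_ge:
  fixes x v :: 'a and s a :: real
  assumes "s > 0" "a \<ge> 0"
  defines "m \<equiv> sqrt \<mu>" and "r \<equiv> rt_mu_s \<mu> s" and "gh \<equiv> g (x + a *\<^sub>R v)"
  shows "- r * ((gh - g x) \<bullet> v) - m * (norm v)\<^sup>2 - r * m * (gh \<bullet> (x - xstar))
      + m / 4 * (r * (f x - f xstar) + 1/4 * (norm v)\<^sup>2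
                 + 1/4 * (norm (v + (2 * m) *\<^sub>R (x - xstar)))\<^sup>2)
    \<le> C_ET f g \<mu> L s a (x, v)"
proof -
  define z where "z = x - xstar"
  have m: "m > 0" "m\<^sup>2 = \<mu>" and r: "r \<ge> 1"
    using mu_pos rt_mu_s_ge_1[OF mu_pos assms(1)] by (auto simp: m_def r_def)
  have young: "(norm (v + (2 * m) *\<^sub>R z))\<^sup>2 \<le> 2 * (norm v)\<^sup>2 + 8 * \<mu> * (norm z)\<^sup>2"
  proof -
    have "2 * (v \<bullet> ((2 * m) *\<^sub>R z)) \<le> (norm v)\<^sup>2 + 4 * \<mu> * (norm z)\<^sup>2"
      using two_inner_le[of v "(2 * m) *\<^sub>R z"] m by (simp add: power_mult_distrib)
    moreover have "(norm (v + (2 * m) *\<^sub>R z))\<^sup>2 = (norm v)\<^sup>2 + 2 * (v \<bullet> ((2 * m) *\<^sub>R z)) + 4 * \<mu> * (norm z)\<^sup>2"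
      unfolding m(2)[symmetric] power2_norm_eq_inner
      by (simp add: inner_add inner_commute power2_eq_square algebra_simps)
    ultimately show ?thesis by simp
  qed
  have sc: "- (gh \<bullet> z) \<le> gh \<bullet> (a *\<^sub>R v) + f xstar - f (x + a *\<^sub>R v)
      - \<mu> / 2 * ((norm z)\<^sup>2 + 2 * (z \<bullet> (a *\<^sub>R v)) + (norm (a *\<^sub>R v))\<^sup>2)"
  proof -
    have "(norm (x + a *\<^sub>R v - xstar))\<^sup>2 = (norm z)\<^sup>2 + 2 * (z \<bullet> (a *\<^sub>R v)) + (norm (a *\<^sub>R v))\<^sup>2"
      unfolding z_def power2_norm_eq_inner
      by (simp add: inner_add inner_diff inner_commute algebra_simps)
    moreover have "gh \<bullet> (xstar - (x + a *\<^sub>R v)) = - (gh \<bullet> z) - gh \<bullet> (a *\<^sub>R v)"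
      by (simp add: z_def inner_diff_right inner_add_right)
    ultimately show ?thesis
      using strongly_convex[of "x + a *\<^sub>R v" xstar] by (simp add: gh_def)
  qed
  \<comment> \<open>The factor \<open>\<mu>\<close> is absorbed by \<open>norm_gradient_ge\<close>,
    so the cross term of \<open>sc\<close> no longer involves the unknown distance to the
    minimizer.\<close>
  have cs: "- \<mu> * (z \<bullet> (a *\<^sub>R v)) \<le> norm (g x) * norm (a *\<^sub>R v)"
  proof -
    have "- (z \<bullet> (a *\<^sub>R v)) \<le> norm z * norm (a *\<^sub>R v)"
      using norm_cauchy_schwarz[of "- z" "a *\<^sub>R v"] by simp
    then have "\<mu> * - (z \<bullet> (a *\<^sub>R v)) \<le> \<mu> * (norm z * norm (a *\<^sub>R v))"
      using mu_pos by (intro mult_left_mono) auto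
    also have "\<dots> \<le> norm (g x) * norm (a *\<^sub>R v)"
      using mult_right_mono[OF norm_gradient_ge[of x], of "norm (a *\<^sub>R v)"] by (simp add: z_def mult_ac)
    finally show ?thesis by simp
  qed
  have lz: "(norm (g x))\<^sup>2 / L\<^sup>2 \<le> (norm z)\<^sup>2"
    using power_mono[OF norm_gradient_le[of x], of 2] L_pos
    by (simp add: z_def divide_le_eq power_mult_distrib mult.commute)
  have rs: "r - 1 = m * sqrt s" by (simp add: r_def rt_mu_s_def m_def real_sqrt_mult)
  have mr: "m * r > 0" using m r by simp
  \<comment> \<open>With the terms \<open>- m\<close> and \<open>m / 16\<close> already present, the
    coefficient of \<open>(norm v)\<^sup>2\<close> becomes - (1 - 1/16 - 1/8) m = - 13 m /
    16.\<close>
  have 1: "m / 16 * (norm (v + (2 * m) *\<^sub>R z))\<^sup>2 \<le> m / 8 * (norm v)\<^sup>2 + m * \<mu> / 2 * (norm z)\<^sup>2"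
    using mult_left_mono[OF young, of "m / 16"] m by (simp add: algebra_simps)
  have 2: "m * r * - (gh \<bullet> z) \<le> m * r * (gh \<bullet> (a *\<^sub>R v) + f xstar - f (x + a *\<^sub>R v)
      - \<mu> / 2 * ((norm z)\<^sup>2 + 2 * (z \<bullet> (a *\<^sub>R v)) + (norm (a *\<^sub>R v))\<^sup>2))"
    using mr by (intro mult_left_mono[OF sc]) simp
  have 3: "m * r * (- \<mu> * (z \<bullet> (a *\<^sub>R v))) \<le> m * r * (norm (g x) * norm (a *\<^sub>R v))"
    using mr by (intro mult_left_mono[OF cs]) simp
  \<comment> \<open>\<open>f xstar - f (x + a *\<^sub>R v)\<close> is
    \<open>f x - f (x + a *\<^sub>R v)\<close> minus the gap at \<open>x\<close>. A quarter of the
    gap is returned by the Lyapunov function; the remaining three quarters are turned into the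
    gradient.\<close>
  have 4: "m * r * 3 / 4 * ((norm (g x))\<^sup>2 / (2 * L)) \<le> m * r * 3 / 4 * (f x - f xstar)"
    using mr by (intro mult_left_mono[OF gap_ge_gradient]) simp
  have 5: "\<mu>\<^sup>2 * sqrt s / 2 * ((norm (g x))\<^sup>2 / L\<^sup>2) \<le> \<mu>\<^sup>2 * sqrt s / 2 * (norm z)\<^sup>2"
    using assms by (intro mult_left_mono[OF lz]) simp
  \<comment> \<open>The terms in \<open>(norm z)\<^sup>2\<close> of \<open>1\<close> and
    \<open>2\<close> add up to - m \<mu> (r - 1) / 2. Since r - 1 = m sqrt s, this is exactly the
    source of the summand with \<open>sqrt s\<close> in \<open>C_ET\<close>.\<close>
  have mu2: "\<mu>\<^sup>2 * sqrt s = m * \<mu> * (r - 1)"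
    unfolding rs m(2)[symmetric] by (simp add: power2_eq_square)
  have 6: "\<mu>\<^sup>2 * sqrt s / 2 * (norm z)\<^sup>2 = m * r * \<mu> / 2 * (norm z)\<^sup>2 - m * \<mu> / 2 * (norm z)\<^sup>2"
    unfolding mu2 by (simp add: field_simps)
  have C_eq: "C_ET f g \<mu> L s a (x, v) = - 13 * m / 16 * (norm v)\<^sup>2
      - \<mu>\<^sup>2 * sqrt s / 2 * ((norm (g x))\<^sup>2 / L\<^sup>2) - m * r * 3 / 4 * ((norm (g x))\<^sup>2 / (2 * L))
      + m * r * (f x - f (x + a *\<^sub>R v)) + m * r * (norm (g x) * norm (a *\<^sub>R v))
      - m * r * \<mu> / 2 * (norm (a *\<^sub>R v))\<^sup>2 - r * ((gh - g x) \<bullet> v) + m * r * (gh \<bullet> (a *\<^sub>R v))"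
    unfolding C_ET_def Let_def fst_conv snd_conv mu_powr_three_halves[OF mu_pos]
      m_def[symmetric] r_def[symmetric] gh_def[symmetric]
    by (simp add: algebra_simps)
  define Q where "Q = m * r * 3 / 4 * ((norm (g x))\<^sup>2 / (2 * L))"
  define R where "R = \<mu>\<^sup>2 * sqrt s / 2 * ((norm (g x))\<^sup>2 / L\<^sup>2)"
  show ?thesis
    using 1 2 3 4 5 6
    unfolding C_eq z_def[symmetric] Q_def[symmetric] R_def[symmetric]
    by (simp add: algebra_simps)
qed

text \<open>The derivative is \<open>A_ET\<close> plus a remainder free of \<open>t\<close>, and
  \<open>sqrt \<mu> / 4\<close> times the Lyapunov function is at most \<open>B_ET\<close> plus its
  value at time 0. Together, the two time-independent remainders are the left-hand side of
  \<open>C_ET_ge\<close>.\<close>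

lemma V_lyap_derivative_le_b_ET:
  fixes x v :: 'a and s a t :: real
  assumes "s > 0" "a \<ge> 0" "t \<ge> 0"
  shows "\<exists>D. ((\<lambda>\<tau>. V_lyap f xstar \<mu> s ((x, v) + \<tau> *\<^sub>R X_hb g \<mu> s a (x, v))) has_real_derivative D) (at t)
    \<and> D + sqrt \<mu> / 4 * V_lyap f xstar \<mu> s ((x, v) + t *\<^sub>R X_hb g \<mu> s a (x, v))
        \<le> b_ET f g \<mu> L s a (x, v) t"
proof -
  define m where "m = sqrt \<mu>"
  define r where "r = rt_mu_s \<mu> s"
  define gh where "gh = g (x + a *\<^sub>R v)"
  define w where "w = - (2 * m) *\<^sub>R v - r *\<^sub>R gh"
  define z where "z = x - xstar"
  define y where "y = v + (2 * m) *\<^sub>R z"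
  define D where "D = r * (g (x + t *\<^sub>R v) \<bullet> v) + 1/2 * ((v + t *\<^sub>R w) \<bullet> w)
       - r / 2 * (gh \<bullet> (y - (t * r) *\<^sub>R gh))"
  have m: "m > 0" "\<mu> = m * m" and r: "r \<ge> 1"
    using mu_pos rt_mu_s_ge_1[OF mu_pos assms(1)] by (auto simp: m_def r_def)
  \<comment> \<open>Expanding the last square of the Lyapunov function (\<open>n2\<close>) leaves a
    term linear in \<open>t\<close> with \<open>gh \<bullet> z\<close>. Cocoercivity at the
    displaced point replaces it by the last two summands of \<open>B_ET\<close>.\<close>
  have coco: "- (gh \<bullet> z) \<le> gh \<bullet> (a *\<^sub>R v) - (norm gh)\<^sup>2 / L"
    using cocoercive_minimizer[of "x + a *\<^sub>R v"]
    by (simp add: gh_def z_def inner_diff_right inner_add_right)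
  have coco': "m * m * r * t * - (gh \<bullet> z) \<le> m * m * r * t * (gh \<bullet> (a *\<^sub>R v) - (norm gh)\<^sup>2 / L)"
    using m r assms by (intro mult_left_mono[OF coco]) simp
  have D_eq: "D = A_ET g \<mu> s a (x, v) t
      + (- r * ((gh - g x) \<bullet> v) - m * (norm v)\<^sup>2 - r * m * (gh \<bullet> z))"
    unfolding D_def w_def y_def A_ET_def Let_def fst_conv snd_conv m_def[symmetric] r_def[symmetric]
      gh_def[symmetric] power2_norm_eq_inner
    by (simp add: m(2) inner_add inner_diff inner_commute field_simps)
  have V_eq: "V_lyap f xstar \<mu> s ((x, v) + t *\<^sub>R X_hb g \<mu> s a (x, v)) =
      r * (f (x + t *\<^sub>R v) - f xstar) + 1/4 * (norm (v + t *\<^sub>R w))\<^sup>2 + 1/4 * (norm (y - (t * r) *\<^sub>R gh))\<^sup>2"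
    unfolding V_lyap_along Let_def m_def[symmetric] r_def[symmetric] gh_def[symmetric]
      w_def[symmetric] z_def[symmetric] y_def[symmetric] by simp
  have n1: "(norm (v + t *\<^sub>R w))\<^sup>2 = (norm v)\<^sup>2 + t\<^sup>2 * (norm ((2 * m) *\<^sub>R v + r *\<^sub>R gh))\<^sup>2
      - 4 * m * t * (norm v)\<^sup>2 - 2 * r * t * (gh \<bullet> v)"
    unfolding w_def power2_norm_eq_inner
    by (simp add: inner_add inner_diff inner_commute power2_eq_square algebra_simps)
  have n2: "(norm (y - (t * r) *\<^sub>R gh))\<^sup>2 = (norm y)\<^sup>2 - 2 * t * r * (gh \<bullet> v) - 4 * t * r * m * (gh \<bullet> z)
      + t\<^sup>2 * r\<^sup>2 * (norm gh)\<^sup>2"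
    unfolding y_def power2_norm_eq_inner
    by (simp add: inner_add inner_diff inner_commute power2_eq_square algebra_simps)
  have B_ge: "m / 4 * V_lyap f xstar \<mu> s ((x, v) + t *\<^sub>R X_hb g \<mu> s a (x, v))
      \<le> B_ET f g \<mu> L s a (x, v) t + m / 4 * (r * (f x - f xstar) + 1/4 * (norm v)\<^sup>2 + 1/4 * (norm y)\<^sup>2)"
    using coco'
    unfolding divide_inverse[of _ L] V_eq n1 n2 B_ET_def Let_def fst_conv snd_conv m_def[symmetric] r_def[symmetric]
      gh_def[symmetric] divide_inverse[of _ L]
    by (simp add: m(2) inner_commute power2_eq_square algebra_simps)
  have "D + m / 4 * V_lyap f xstar \<mu> s ((x, v) + t *\<^sub>R X_hb g \<mu> s a (x, v)) \<le> b_ET f g \<mu> L s a (x, v) t"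
    using D_eq B_ge C_ET_ge[OF assms(1,2), of x v]
    unfolding b_ET_def m_def[symmetric] r_def[symmetric] gh_def[symmetric] z_def[symmetric]
      y_def[symmetric] by linarith
  moreover have "((\<lambda>\<tau>. V_lyap f xstar \<mu> s ((x, v) + \<tau> *\<^sub>R X_hb g \<mu> s a (x, v))) has_real_derivative D) (at t)"
    using V_lyap_has_real_derivative[of s x v a t]
    unfolding D_def m_def[symmetric] r_def[symmetric] gh_def[symmetric] z_def[symmetric]
      y_def[symmetric] w_def[symmetric] .
  ultimately show ?thesis unfolding m_def by blast
qed

text \<open>Only two terms of \<open>b_ET\<close> depend on \<open>t\<close> through
  \<open>f\<close> or \<open>g\<close>: the gradient increment, bounded by the Lipschitz constant,
  and the increment of \<open>f\<close>, bounded by \<open>descent\<close>.\<close>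

lemma b_ET_le_b_ST:
  fixes x v :: 'a and s a t :: real
  assumes "s > 0" "t \<ge> 0"
  shows "b_ET f g \<mu> L s a (x, v) t \<le> b_ST f g \<mu> L s a (x, v) t"
proof -
  define m where "m = sqrt \<mu>"
  define r where "r = rt_mu_s \<mu> s"
  define gh where "gh = g (x + a *\<^sub>R v)"
  have m: "m > 0" "\<mu> = m * m" and r: "r \<ge> 1"
    using mu_pos rt_mu_s_ge_1[OF mu_pos assms(1)] by (auto simp: m_def r_def)
  have 1: "r * ((g (x + t *\<^sub>R v) - g x) \<bullet> v) \<le> r * (L * t * (norm v)\<^sup>2)"
    using r by (intro mult_left_mono[OF gradient_diff_inner_le[OF assms(2)]]) simp
  have 2: "m * r / 4 * f (x + t *\<^sub>R v) \<le> m * r / 4 * (f x + t * (g x \<bullet> v) + L / 2 * t\<^sup>2 * (norm v)\<^sup>2)"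
    using m r by (intro mult_left_mono[OF descent[OF assms(2)]]) simp
  show ?thesis
    using 1 2
    unfolding b_ET_def b_ST_def A_ET_def B_ET_def A_ST_def Bl_ST_def Bq_ST_def C_ST_def Let_def
      fst_conv snd_conv m_def[symmetric] r_def[symmetric] gh_def[symmetric]
    by (simp add: m(2) inner_diff inner_commute power2_eq_square algebra_simps)
qed

end

section \<open>The constants of the stepsize bound\<close>

text \<open>\<open>q\<close> is the bound on the coefficient of \<open>t\<^sup>2 |v|\<^sup>2\<close> in \<open>b_ST\<close>; \<open>2 q nu1\<close> and \<open>- q eta1\<close> are those
  for \<open>t |v|\<^sup>2\<close> and \<open>|v|\<^sup>2\<close>. The next lemma does the same for \<open>|g x|\<^sup>2\<close>.\<close>

lemma eta1_nu1_eq: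
  fixes \<mu> L s a :: real
  assumes "\<mu> > 0" "L > 0" "s > 0"
  defines "q \<equiv> sqrt \<mu> / 8 * (rt_mu_s \<mu> s * L * (3 * a\<^sup>2 * rt_mu_s \<mu> s * L + 1) + 4 * \<mu>)"
  shows "q > 0"
    and "q * eta1 \<mu> L s a = beta3 \<mu> - beta1 \<mu> L s * a - beta5 \<mu> L s * a\<^sup>2"
    and "2 * q * nu1 \<mu> L s a =
      (let m = sqrt \<mu>; r = rt_mu_s \<mu> s in
        2 * \<mu> + \<mu> * a * r / 8 + \<mu> * a^3 * r * L\<^sup>2 / 4 + 2 * a\<^sup>2 * r\<^sup>2 * L\<^sup>2 + r * L
        + m * r * a * L / 4 + 2 * m * r * a\<^sup>2 * L\<^sup>2 + m * r)"
proof -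
  define m where "m = sqrt \<mu>"
  define r where "r = rt_mu_s \<mu> s"
  define D where "D = r * L * (3 * a\<^sup>2 * r * L + 1) + 4 * \<mu>"
  have m: "m > 0" "\<mu> = m * m" and r: "r \<ge> 1"
    using assms rt_mu_s_ge_1[OF assms(1,3)] by (auto simp: m_def r_def)
  have D: "D > 0" unfolding D_def using r assms
    by (intro add_nonneg_pos mult_nonneg_nonneg add_nonneg_nonneg) auto
  have q: "q = m / 8 * D" unfolding q_def D_def m_def r_def ..
  show "q > 0" using m D by (simp add: q)
  have den: "2 * r * L * (3 * a\<^sup>2 * r * L + 1) + 8 * \<mu> = 2 * D"
    by (simp add: D_def)
  show "q * eta1 \<mu> L s a = beta3 \<mu> - beta1 \<mu> L s * a - beta5 \<mu> L s * a\<^sup>2"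
    unfolding eta1_def Let_def beta1_def beta3_def beta5_def mu_powr_three_halves[OF assms(1)]
      m_def[symmetric] r_def[symmetric] den q
    using m(1) D by (simp add: m(2) field_simps power2_eq_square)
  have nu: "nu1 \<mu> L s a =
     (\<mu> * (2 * a^3 * r * L\<^sup>2 + a * r + 16) + 8 * r * L * (2 * a\<^sup>2 * r * L + 1)) / (2 * m * D)
     + r * (a * L * (8 * a * L + 1) + 4) / D"
    unfolding nu1_def Let_def m_def[symmetric] r_def[symmetric] D_def[symmetric] ..
  have cancel: "2 * (m / 8 * D) * (b / (2 * m * D) + c / D) = b / 8 + m * c / 4" for b c
    using m(1) D by (simp add: field_simps)
  show "2 * q * nu1 \<mu> L s a = (let m = sqrt \<mu>; r = rt_mu_s \<mu> s in
        2 * \<mu> + \<mu> * a * r / 8 + \<mu> * a^3 * r * L\<^sup>2 / 4 + 2 * a\<^sup>2 * r\<^sup>2 * L\<^sup>2 + r * L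
        + m * r * a * L / 4 + 2 * m * r * a\<^sup>2 * L\<^sup>2 + m * r)"
    unfolding Let_def nu q cancel m_def[symmetric] r_def[symmetric]
    by (simp add: field_simps power2_eq_square power3_eq_cube)
qed

lemma eta2_nu2_eq:
  fixes \<mu> L s a :: real
  assumes "\<mu> > 0" "L > 0" "s > 0"
  defines "q \<equiv> 3 * (rt_mu_s \<mu> s)\<^sup>2 * sqrt \<mu> / 8"
  shows "q > 0"
    and "q * eta2 \<mu> L s a = beta4 \<mu> L s - beta2 \<mu> s * a"
    and "2 * q * nu2 \<mu> s a =
      (let r = rt_mu_s \<mu> s in r * a * \<mu> / 4 + 2 * r\<^sup>2 + 2 * sqrt \<mu> * r)"
proof -
  define m where "m = sqrt \<mu>"
  define r where "r = rt_mu_s \<mu> s"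
  have m: "m > 0" "\<mu> = m * m" and r: "r \<ge> 1"
    using assms rt_mu_s_ge_1[OF assms(1,3)] by (auto simp: m_def r_def)
  have mu_s: "mu_s \<mu> s = r * r" by (simp add: mu_s_def r_def rt_mu_s_def power2_eq_square)
  show "q > 0" unfolding q_def m_def[symmetric] r_def[symmetric] using m(1) r by simp
  have cancel: "3 * r\<^sup>2 * m / 8 * (b / (3 * (r * r) * m * L\<^sup>2)) = b / (8 * L\<^sup>2)" for b
    using m(1) r by (simp add: power2_eq_square[of r])
  have cancel': "2 * (3 * r\<^sup>2 * m / 8) * (b / (3 * r * m)) = r * b / 4" for b
    using m(1) r by (simp add: power2_eq_square)
  show "q * eta2 \<mu> L s a = beta4 \<mu> L s - beta2 \<mu> s * a"
    unfolding q_def eta2_def Let_def beta2_def beta4_def mu_s m_def[symmetric] r_def[symmetric]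
      mult_minus_right cancel
    using assms by (simp add: diff_divide_distrib add_divide_distrib power2_eq_square algebra_simps)
  show "2 * q * nu2 \<mu> s a = (let r = rt_mu_s \<mu> s in r * a * \<mu> / 4 + 2 * r\<^sup>2 + 2 * sqrt \<mu> * r)"
    unfolding q_def nu2_def Let_def m_def[symmetric] r_def[symmetric] cancel'
    by (simp add: field_simps power2_eq_square)
qed

lemma beta_pos:
  assumes "\<mu> > 0" "L > 0" "s > 0" "\<mu> \<le> L"
  shows "0 < beta1 \<mu> L s" "0 < beta2 \<mu> s" "0 < beta3 \<mu>" "0 < beta4 \<mu> L s" "0 < beta5 \<mu> L s"
proof -
  have r: "rt_mu_s \<mu> s > 0" using rt_mu_s_ge_1[OF assms(1,3)] by simp
  show "0 < beta1 \<mu> L s" "0 < beta2 \<mu> s" "0 < beta3 \<mu>"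
    using assms r by (simp_all add: beta1_def beta2_def beta3_def add_pos_pos)
  show "0 < beta4 \<mu> L s"
    unfolding beta4_def using assms r by (intro divide_pos_pos add_pos_pos mult_pos_pos) auto
  \<comment> \<open>In this form the sign is that of \<open>5 * L - \<mu>\<close>, which is where
    \<open>\<mu> \<le> L\<close> enters.\<close>
  have "beta5 \<mu> L s = rt_mu_s \<mu> s * (sqrt \<mu> * (5 * L - \<mu>) / 2)"
    unfolding beta5_def mu_powr_three_halves[OF assms(1)] by (simp add: field_simps)
  then show "0 < beta5 \<mu> L s"
    using assms r by (simp only:) (intro mult_pos_pos divide_pos_pos; simp)
qed

section \<open>Thresholds as roots of quadratics\<close>

lemma below_quadratic_root:
  fixes b c d a :: real
  assumes "b > 0" "c > 0" "0 \<le> a" "a < (- b + sqrt (b\<^sup>2 + 4 * c * d)) / (2 * c)"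
  shows "b * a + c * a\<^sup>2 < d"
proof -
  have 1: "2 * c * a + b < sqrt (b\<^sup>2 + 4 * c * d)"
    using assms by (simp add: field_simps)
  \<comment> \<open>Nonnegativity of the left-hand side of \<open>1\<close> permits squaring; the
    square is then undone by dividing by \<open>4 * c\<close>.\<close>
  have "0 \<le> 2 * c * a + b" using assms by simp
  with 1 have "(2 * c * a + b)\<^sup>2 < b\<^sup>2 + 4 * c * d"
    by (metis abs_of_nonneg real_sqrt_abs real_sqrt_less_iff)
  then have "4 * c * (b * a + c * a\<^sup>2) < 4 * c * d"
    by (simp add: power2_eq_square algebra_simps)
  then show ?thesis using assms by simp
qed

text \<open>Each argument of the minimum in \<open>a2_star\<close> is the point where one of the two
  coefficients vanishes; since the minimum is positive, the factor \<alpha> < 1 keeps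
  \<open>a\<close> strictly below both.\<close>

lemma coefficients_pos:
  assumes "\<mu> > 0" "L > 0" "s > 0" "\<mu> \<le> L" "0 < \<alpha>" "\<alpha> < 1" "0 \<le> a" "a \<le> a2_star \<alpha> \<mu> L s"
  shows "0 < beta3 \<mu> - beta1 \<mu> L s * a - beta5 \<mu> L s * a\<^sup>2"
    and "0 < beta4 \<mu> L s - beta2 \<mu> s * a"
proof -
  note beta = beta_pos[OF assms(1-4)]
  define \<rho> where "\<rho> = (- beta1 \<mu> L s + sqrt ((beta1 \<mu> L s)\<^sup>2 + 4 * beta5 \<mu> L s * beta3 \<mu>)) / (2 * beta5 \<mu> L s)"
  define \<sigma> where "\<sigma> = beta4 \<mu> L s / beta2 \<mu> s"
  have "beta1 \<mu> L s < sqrt ((beta1 \<mu> L s)\<^sup>2 + 4 * beta5 \<mu> L s * beta3 \<mu>)"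
    using beta by (intro real_less_rsqrt) simp
  then have "\<rho> > 0" using beta by (simp add: \<rho>_def)
  moreover have "\<sigma> > 0" using beta by (simp add: \<sigma>_def)
  ultimately have "min \<rho> \<sigma> > 0" by simp
  from mult_strict_right_mono[OF assms(6) this]
  have "\<alpha> * min \<rho> \<sigma> < min \<rho> \<sigma>" by simp
  with assms(8) have "a < min \<rho> \<sigma>"
    unfolding a2_star_def \<rho>_def[symmetric] \<sigma>_def[symmetric] by (rule le_less_trans)
  then have a: "a < \<rho>" "a < \<sigma>" by simp_all
  show "0 < beta3 \<mu> - beta1 \<mu> L s * a - beta5 \<mu> L s * a\<^sup>2"
    using below_quadratic_root[OF beta(1,5) assms(7) a(1)[unfolded \<rho>_def]] by simp
  show "0 < beta4 \<mu> L s - beta2 \<mu> s * a"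
    using a(2) beta by (simp add: \<sigma>_def field_simps)
qed

lemma eta_pos:
  assumes "\<mu> > 0" "L > 0" "s > 0" "\<mu> \<le> L" "0 < \<alpha>" "\<alpha> < 1" "0 \<le> a" "a \<le> a2_star \<alpha> \<mu> L s"
  shows "eta1 \<mu> L s a > 0" and "eta2 \<mu> L s a > 0"
  using eta1_nu1_eq(1,2)[OF assms(1-3), of a] eta2_nu2_eq(1)[OF assms(1-3)]
    eta2_nu2_eq(2)[OF assms(1-3), of a] coefficients_pos[OF assms]
  by (metis zero_less_mult_pos)+

text \<open>Makes the maximum of \<open>nu1\<close> and \<open>nu2\<close> positive, which justifies
  the squaring in \<open>below_MIET\<close>.\<close>

lemma nu2_pos: "nu2 \<mu> s a > 0" if "\<mu> > 0" "s > 0" "a \<ge> 0"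
  unfolding nu2_def Let_def using that rt_mu_s_ge_1[of \<mu> s]
  by (intro divide_pos_pos add_nonneg_pos) auto

lemma MIET_pos:
  assumes "eta1 \<mu> L s a > 0" "eta2 \<mu> L s a > 0"
  shows "MIET \<mu> L s a > 0"
proof -
  define \<nu> where "\<nu> = max (nu1 \<mu> L s a) (nu2 \<mu> s a)"
  have "\<nu> < sqrt (\<nu>\<^sup>2 + min (eta1 \<mu> L s a) (eta2 \<mu> L s a))"
    using assms by (intro real_less_rsqrt) simp
  then show ?thesis by (simp add: MIET_def \<nu>_def Let_def)
qed

text \<open>\<open>MIET\<close> is a root of t^2 + 2 \<nu> t = \<eta>. As \<nu> is the larger of the
  two linear coefficients and \<eta> the smaller of the two right-hand sides, staying below that
  root gives both inequalities.\<close>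

lemma below_MIET:
  assumes "nu2 \<mu> s a > 0" "0 \<le> t" "t < MIET \<mu> L s a"
  shows "t\<^sup>2 + 2 * nu1 \<mu> L s a * t < eta1 \<mu> L s a"
    and "t\<^sup>2 + 2 * nu2 \<mu> s a * t < eta2 \<mu> L s a"
proof -
  define \<eta> where "\<eta> = min (eta1 \<mu> L s a) (eta2 \<mu> L s a)"
  define \<nu> where "\<nu> = max (nu1 \<mu> L s a) (nu2 \<mu> s a)"
  have 1: "t + \<nu> < sqrt (\<nu>\<^sup>2 + \<eta>)"
    using assms(3) by (simp add: MIET_def \<eta>_def \<nu>_def Let_def)
  have "0 \<le> t + \<nu>" using assms by (simp add: \<nu>_def)
  with 1 have "(t + \<nu>)\<^sup>2 < \<nu>\<^sup>2 + \<eta>"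
    by (metis abs_of_nonneg real_sqrt_abs real_sqrt_less_iff)
  then have "t\<^sup>2 + 2 * \<nu> * t < \<eta>" by (simp add: power2_eq_square algebra_simps)
  moreover have "2 * nu1 \<mu> L s a * t \<le> 2 * \<nu> * t" "2 * nu2 \<mu> s a * t \<le> 2 * \<nu> * t"
    using assms by (simp_all add: \<nu>_def mult_right_mono)
  ultimately show "t\<^sup>2 + 2 * nu1 \<mu> L s a * t < eta1 \<mu> L s a" "t\<^sup>2 + 2 * nu2 \<mu> s a * t < eta2 \<mu> L s a"
    by (simp_all add: \<eta>_def)
qed

section \<open>Existence of a first positive zero\<close>

lemma quadratic_eventually_pos:
  fixes c :: real
  assumes "c > 0"
  obtains t where "t > 0" "c * t\<^sup>2 + d * t + e > 0"
proof -
  \<comment> \<open>Large enough for \<open>c * t + d\<close> to reach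
    \<open>\<bar>e\<bar> + 1\<close>, and at least 1 so that multiplying by \<open>t\<close>
    preserves this bound.\<close>
  define t where "t = (\<bar>d\<bar> + \<bar>e\<bar> + 1) / c + 1"
  have t: "t \<ge> 1" using assms by (simp add: t_def)
  have "c * t = \<bar>d\<bar> + \<bar>e\<bar> + 1 + c" using assms by (simp add: t_def field_simps)
  then have "c * t + d \<ge> \<bar>e\<bar> + 1" using assms by simp
  then have "(c * t + d) * t \<ge> (\<bar>e\<bar> + 1) * t" using t by (intro mult_right_mono) auto
  moreover have "(\<bar>e\<bar> + 1) * t \<ge> \<bar>e\<bar> + 1" using t by (simp add: mult_le_cancel_left1)
  ultimately have "c * t\<^sup>2 + d * t + e > 0" by (simp add: power2_eq_square algebra_simps)
  with t show thesis by (intro that[of t]) auto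
qed

text \<open>The zeros in \<open>{0..T}\<close> form a compact set, nonempty by the intermediate
  value theorem, so there is a least one. A positive value before it would force a still earlier
  zero, because \<open>h\<close> starts negative.\<close>

lemma first_positive_zero:
  fixes h :: "real \<Rightarrow> real"
  assumes cont: "continuous_on UNIV h" and neg: "h 0 < 0" and T: "T > 0" "h T > 0"
  obtains d where "d > 0" "h d = 0" "\<And>t. t > 0 \<Longrightarrow> h t = 0 \<Longrightarrow> d \<le> t"
    "\<And>t. t \<in> {0..d} \<Longrightarrow> h t \<le> 0"
proof -
  have ivt: "\<exists>t\<ge>0. t \<le> b \<and> h t = 0" if "b \<ge> 0" "h b \<ge> 0" for b
    using IVT'[of h 0 0 b] that neg continuous_on_subset[OF cont] by auto
  define Z where "Z = {0..T} \<inter> {t. h t = 0}"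
  have "closed {t. h t = 0}"
    using cont by (intro closed_Collect_eq) auto
  then have "compact Z" unfolding Z_def by (intro compact_Int_closed) auto
  moreover have "Z \<noteq> {}" using ivt[of T] T unfolding Z_def by fastforce
  ultimately obtain d where d: "d \<in> Z" "\<And>t. t \<in> Z \<Longrightarrow> d \<le> t"
    using compact_attains_inf[of Z] by blast
  have dmin: "d \<le> t" if "t \<ge> 0" "h t = 0" for t
    using d that by (cases "t \<le> T") (auto simp: Z_def)
  have "h t \<le> 0" if "t \<in> {0..d}" for t
  proof (rule ccontr)
    assume "\<not> h t \<le> 0"
    then have "\<exists>u\<ge>0. u \<le> t \<and> h u = 0" using that by (intro ivt) auto
    then obtain u where "u \<ge> 0" "u \<le> t" "h u = 0" by blast
    then have "t = u" using dmin[of u] that by auto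
    with \<open>h u = 0\<close> \<open>\<not> h t \<le> 0\<close> show False by simp
  qed
  moreover have "d > 0" using d neg by (cases "d = 0") (auto simp: Z_def)
  moreover have "h d = 0" using d by (simp add: Z_def)
  ultimately show thesis using dmin by (intro that[of d]) auto
qed

lemma is_step_imp_step_eq:
  assumes "is_step trig f g \<mu> L s a p d"
  shows "step trig f g \<mu> L s a p = d"
  unfolding step_def using assms by (intro Least_equality) (auto simp: is_step_def)

section \<open>Stepsizes and convergence\<close>

context strongly_convex_smooth
begin

text \<open>Along \<open>v\<close> the gradient increment at \<open>xstar\<close> is bounded below
  through \<mu> and above through \<open>L\<close>. A nonzero vector is required: in the zero space
  nothing relates the two constants.\<close>

lemma mu_le_L:
  fixes v :: 'a
  assumes "v \<noteq> 0"
  shows "\<mu> \<le> L"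
proof -
  have "\<mu> * (norm v)\<^sup>2 \<le> L * (norm v)\<^sup>2"
    using gradient_strongly_monotone[of "xstar" "xstar + v"] gradient_diff_inner_le[of 1 xstar v]
    by (simp add: inner_diff_left)
  then show ?thesis using assms by simp
qed

section \<open>Upper bounds on the trigger functions\<close>

text \<open>Strong convexity at \<open>x\<close> bounds the decrease of \<open>f\<close>, Young's
  inequality the product of norms, and the Lipschitz property the gradient differences, so that only
  the squared norms of \<open>v\<close> and \<open>g x\<close> remain.\<close>

lemma C_ET_le:
  fixes x v :: 'a and s a :: real
  assumes "s > 0" "a \<ge> 0"
  shows "C_ET f g \<mu> L s a (x, v) \<le>
    - (beta3 \<mu> - beta1 \<mu> L s * a - beta5 \<mu> L s * a\<^sup>2) * (norm v)\<^sup>2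
    - (beta4 \<mu> L s - beta2 \<mu> s * a) * (norm (g x))\<^sup>2"
proof -
  define m where "m = sqrt \<mu>"
  define r where "r = rt_mu_s \<mu> s"
  define gh where "gh = g (x + a *\<^sub>R v)"
  define N where "N = (norm v)\<^sup>2"
  define G where "G = (norm (g x))\<^sup>2"
  have m: "m > 0" "\<mu> = m * m" and r: "r \<ge> 1"
    using mu_pos rt_mu_s_ge_1[OF mu_pos assms(1)] by (auto simp: m_def r_def)
  have N: "N \<ge> 0" and G: "G \<ge> 0" by (simp_all add: N_def G_def)
  have d: "gh \<bullet> v - g x \<bullet> v \<le> L * a * N"
    using gradient_diff_inner_le[OF assms(2), of x v] by (simp add: gh_def N_def inner_diff_left)
  have d': "g x \<bullet> v - gh \<bullet> v \<le> L * a * N"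
  proof -
    have "- ((gh - g x) \<bullet> v) \<le> norm (gh - g x) * norm v"
      using norm_cauchy_schwarz[of "- (gh - g x)" v] by (simp add: inner_diff_left norm_minus_commute)
    also have "\<dots> \<le> (L * (a * norm v)) * norm v"
      using norm_gradient_diff_le[of "x + a *\<^sub>R v" x] assms
      by (intro mult_right_mono) (auto simp: gh_def)
    finally show ?thesis by (simp add: N_def inner_diff_left power2_eq_square)
  qed
  have sc: "f x - f (x + a *\<^sub>R v) \<le> - a * (g x \<bullet> v) - \<mu> / 2 * (a\<^sup>2 * N)"
    using strongly_convex[of x "x + a *\<^sub>R v"] by (simp add: N_def power_mult_distrib)
  have y: "norm (g x) * (a * norm v) \<le> a / 2 * G + a / 2 * N"
    using mult_left_mono[OF zero_le_power2[of "norm (g x) - norm v"], of "a / 2"] assms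
    by (simp add: G_def N_def power2_eq_square algebra_simps)
  have 1: "m * r * (f x - f (x + a *\<^sub>R v)) \<le> m * r * (- a * (g x \<bullet> v) - \<mu> / 2 * (a\<^sup>2 * N))"
    using m r by (intro mult_left_mono[OF sc]) simp
  have 2: "m * r * (norm (g x) * (a * norm v)) \<le> m * r * (a / 2 * G + a / 2 * N)"
    using m r by (intro mult_left_mono[OF y]) simp
  \<comment> \<open>Splitting \<open>gh \<bullet> v\<close> in this way leaves a multiple of
    \<open>g x \<bullet> v\<close> that cancels against the linear term of \<open>1\<close>.\<close>
  have 3: "m * r * a * (gh \<bullet> v - g x \<bullet> v) \<le> m * r * a * (L * a * N)"
    using m r assms by (intro mult_left_mono[OF d]) simp
  have 4: "r * (g x \<bullet> v - gh \<bullet> v) \<le> r * (L * a * N)"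
    using r by (intro mult_left_mono[OF d']) simp
  have "C_ET f g \<mu> L s a (x, v) = - 13 * m / 16 * N - \<mu>\<^sup>2 * sqrt s / 2 * (G / L\<^sup>2)
      - 3 * m * r / (8 * L) * G + m * r * (f x - f (x + a *\<^sub>R v)) + m * r * (norm (g x) * (a * norm v))
      - m * r * \<mu> / 2 * (a\<^sup>2 * N) + r * (g x \<bullet> v - gh \<bullet> v) + m * r * a * (gh \<bullet> v)"
    unfolding C_ET_def Let_def fst_conv snd_conv mu_powr_three_halves[OF mu_pos] m_def[symmetric]
      r_def[symmetric] gh_def[symmetric] G_def N_def
    using assms by (simp add: inner_diff_left power_mult_distrib algebra_simps)
  also have "\<dots> \<le> - 13 * m / 16 * N - \<mu>\<^sup>2 * sqrt s / 2 * (G / L\<^sup>2) - 3 * m * r / (8 * L) * G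
      + m * r * (a / 2 * G + a / 2 * N) - m * r * \<mu> * a\<^sup>2 * N + r * L * a * N + m * r * L * a\<^sup>2 * N"
    using 1 2 3 4 by (simp add: power2_eq_square algebra_simps)
  \<comment> \<open>The constants \<open>beta1\<close>, \<open>beta2\<close> and
    \<open>beta5\<close> are larger than this estimate gives; the bracket collects the nonnegative
    slack.\<close>
  also have "\<dots> = - (beta3 \<mu> - beta1 \<mu> L s * a - beta5 \<mu> L s * a\<^sup>2) * N - (beta4 \<mu> L s - beta2 \<mu> s * a) * G
      - (m * r * a * N + m * r * a * G + m * r * a\<^sup>2 * N * (3 * L + \<mu>) / 2)"
    unfolding beta1_def beta2_def beta3_def beta4_def beta5_def mu_powr_three_halves[OF mu_pos]
      m_def[symmetric] r_def[symmetric]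
    using L_pos by (simp add: field_simps power2_eq_square)
  also have "\<dots> \<le> - (beta3 \<mu> - beta1 \<mu> L s * a - beta5 \<mu> L s * a\<^sup>2) * N - (beta4 \<mu> L s - beta2 \<mu> s * a) * G"
  proof -
    have "0 \<le> m * r * a * N" "0 \<le> m * r * a * G" "0 \<le> m * r * a\<^sup>2 * N * (3 * L + \<mu>) / 2"
      using m(1) r assms N G L_pos mu_pos by simp_all
    then show ?thesis by linarith
  qed
  finally show ?thesis unfolding N_def G_def .
qed

text \<open>The coefficients of \<open>t\<^sup>2\<close>, \<open>t\<close> and 1 are bounded
  separately in \<open>Bq\<close>, \<open>lin\<close> and \<open>C\<close>, and
  \<open>gradient_sq_bound\<close> removes the displaced gradient. The numbers \<open>eta1\<close>,
  \<open>eta2\<close>, \<open>nu1\<close>, \<open>nu2\<close> are these bounds normalized by the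
  leading coefficients \<open>q1\<close> and \<open>q2\<close>.\<close>

lemma b_ST_le:
  fixes x v :: 'a and s a t :: real
  assumes "s > 0" "a \<ge> 0" "t \<ge> 0"
  defines "q1 \<equiv> sqrt \<mu> / 8 * (rt_mu_s \<mu> s * L * (3 * a\<^sup>2 * rt_mu_s \<mu> s * L + 1) + 4 * \<mu>)"
    and "q2 \<equiv> 3 * (rt_mu_s \<mu> s)\<^sup>2 * sqrt \<mu> / 8"
  shows "b_ST f g \<mu> L s a (x, v) t \<le>
    q1 * (t\<^sup>2 + 2 * nu1 \<mu> L s a * t - eta1 \<mu> L s a) * (norm v)\<^sup>2
    + q2 * (t\<^sup>2 + 2 * nu2 \<mu> s a * t - eta2 \<mu> L s a) * (norm (g x))\<^sup>2"
proof -
  define m where "m = sqrt \<mu>"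
  define r where "r = rt_mu_s \<mu> s"
  define gh where "gh = g (x + a *\<^sub>R v)"
  define N where "N = (norm v)\<^sup>2"
  define G where "G = (norm (g x))\<^sup>2"
  define H where "H = (norm gh)\<^sup>2"
  define P where "P = gh \<bullet> v"
  define Q where "Q = (g x - gh) \<bullet> v"
  have m: "m > 0" "\<mu> = m * m" and r: "r \<ge> 1"
    using mu_pos rt_mu_s_ge_1[OF mu_pos assms(1)] by (auto simp: m_def r_def)
  have N: "N \<ge> 0" and G: "G \<ge> 0" and H0: "H \<ge> 0" by (simp_all add: N_def G_def H_def)
  have H: "H \<le> 2 * a\<^sup>2 * L\<^sup>2 * N + 2 * G"
    using gradient_sq_bound unfolding H_def N_def G_def gh_def .
  have P: "2 * P \<le> H + N"
    using two_inner_le[of gh v] by (simp add: P_def H_def N_def)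
  have d': "Q \<le> L * a * N"
  proof -
    have "Q \<le> norm (g x - gh) * norm v"
      unfolding Q_def by (rule norm_cauchy_schwarz)
    also have "\<dots> \<le> (L * (a * norm v)) * norm v"
      using norm_gradient_diff_le[of x "x + a *\<^sub>R v"] assms
      by (intro mult_right_mono) (auto simp: gh_def)
    finally show ?thesis by (simp add: N_def power2_eq_square)
  qed
  have sq: "(norm ((2 * m) *\<^sub>R v + r *\<^sub>R gh))\<^sup>2 \<le> 8 * \<mu> * N + 2 * r\<^sup>2 * H"
  proof -
    have "(norm ((2 * m) *\<^sub>R v + r *\<^sub>R gh))\<^sup>2 = 4 * \<mu> * N + r\<^sup>2 * H + 2 * (((2 * m) *\<^sub>R v) \<bullet> (r *\<^sub>R gh))"
      unfolding N_def H_def power2_norm_eq_inner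
      by (simp add: m(2) inner_add inner_commute power2_eq_square algebra_simps)
    moreover have "2 * (((2 * m) *\<^sub>R v) \<bullet> (r *\<^sub>R gh)) \<le> 4 * \<mu> * N + r\<^sup>2 * H"
      using two_inner_le[of "(2 * m) *\<^sub>R v" "r *\<^sub>R gh"]
      by (simp add: N_def H_def m(2) power_mult_distrib power2_eq_square[of m])
    ultimately show ?thesis by linarith
  qed
  have Bq: "Bq_ST g \<mu> L s a (x, v) \<le> q1 * N + q2 * G"
  proof -
    have "Bq_ST g \<mu> L s a (x, v) \<le> m / 16 * (8 * \<mu> * N + 2 * r\<^sup>2 * H) + m * r / 4 * (L / 2 * N + r / 4 * H)"
      unfolding Bq_ST_def Let_def fst_conv snd_conv m_def[symmetric] r_def[symmetric] gh_def[symmetric]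
        N_def[symmetric] H_def[symmetric]
      using m by (intro add_right_mono mult_left_mono[OF sq]) simp
    also have "\<dots> = m * \<mu> / 2 * N + m * r * L / 8 * N + 3 * m * r\<^sup>2 / 16 * H"
      by (simp add: power2_eq_square algebra_simps)
    also have "\<dots> \<le> m * \<mu> / 2 * N + m * r * L / 8 * N + 3 * m * r\<^sup>2 / 16 * (2 * a\<^sup>2 * L\<^sup>2 * N + 2 * G)"
      using m by (intro add_left_mono mult_left_mono[OF H]) simp
    also have "\<dots> = q1 * N + q2 * G"
      unfolding q1_def q2_def m_def[symmetric] r_def[symmetric]
      by (simp add: power2_eq_square field_simps)
    finally show ?thesis .
  qed
  have lin: "A_ST g \<mu> L s a (x, v) + Bl_ST g \<mu> L s a (x, v) \<le> 2 * q1 * nu1 \<mu> L s a * N + 2 * q2 * nu2 \<mu> s a * G"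
  proof -
    \<comment> \<open>The factor collects the multiples of \<open>gh \<bullet> v\<close> in
      \<open>A_ST\<close> and \<open>Bl_ST\<close>; the resulting \<open>H\<close> is merged with
      \<open>r\<^sup>2 * H\<close> in \<open>3\<close>.\<close>
    have 1: "(r * m + \<mu> * r * a / 8) * (2 * P) \<le> (r * m + \<mu> * r * a / 8) * (H + N)"
      using m r assms mu_pos by (intro mult_left_mono[OF P]) simp
    have 2: "m * r / 4 * Q \<le> m * r / 4 * (L * a * N)"
      using m r by (intro mult_left_mono[OF d']) simp
    have 3: "(r * m + \<mu> * r * a / 8 + r\<^sup>2) * H \<le> (r * m + \<mu> * r * a / 8 + r\<^sup>2) * (2 * a\<^sup>2 * L\<^sup>2 * N + 2 * G)"
      using m r assms mu_pos by (intro mult_left_mono[OF H]) simp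
    \<comment> \<open>These two terms enter with a minus sign and are discarded.\<close>
    have 4: "0 \<le> \<mu> / 4 * N + m * r / 4 * (m / L) * H"
      using m r L_pos mu_pos N H0 by simp
    have "A_ST g \<mu> L s a (x, v) + Bl_ST g \<mu> L s a (x, v) =
        2 * \<mu> * N + r * L * N + (r * m + \<mu> * r * a / 8) * (2 * P) + r\<^sup>2 * H
        + m * r / 4 * Q - (\<mu> / 4 * N + m * r / 4 * (m / L) * H)"
      unfolding A_ST_def Bl_ST_def Let_def fst_conv snd_conv m_def[symmetric] r_def[symmetric]
        gh_def[symmetric] N_def[symmetric] H_def[symmetric] inner_scaleR_left inner_commute[of v gh]
        P_def[symmetric] Q_def[symmetric]
      by (simp add: m(2) power2_eq_square algebra_simps)
    also have "\<dots> \<le> 2 * \<mu> * N + r * L * N + (r * m + \<mu> * r * a / 8) * N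
        + (r * m + \<mu> * r * a / 8 + r\<^sup>2) * (2 * a\<^sup>2 * L\<^sup>2 * N + 2 * G) + m * r / 4 * (L * a * N)"
      using 1 2 3 4 unfolding distrib_left[of "r * m + \<mu> * r * a / 8"]
        distrib_right[of "r * m + \<mu> * r * a / 8" "r\<^sup>2" H] by linarith
    also have "\<dots> = 2 * q1 * nu1 \<mu> L s a * N + 2 * q2 * nu2 \<mu> s a * G"
      unfolding q1_def q2_def eta1_nu1_eq(3)[OF mu_pos L_pos assms(1)]
        eta2_nu2_eq(3)[OF mu_pos L_pos assms(1)] Let_def
      unfolding m_def[symmetric] r_def[symmetric]
      by (simp add: power2_eq_square power3_eq_cube field_simps)
    finally show ?thesis .
  qed
  have C: "C_ET f g \<mu> L s a (x, v) \<le> - (q1 * eta1 \<mu> L s a) * N - (q2 * eta2 \<mu> L s a) * G"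
    using C_ET_le[OF assms(1,2), of x v]
    unfolding q1_def q2_def eta1_nu1_eq(2)[OF mu_pos L_pos assms(1)]
      eta2_nu2_eq(2)[OF mu_pos L_pos assms(1)] N_def G_def .
  have "b_ST f g \<mu> L s a (x, v) t \<le> (q1 * N + q2 * G) * t\<^sup>2
      + (2 * q1 * nu1 \<mu> L s a * N + 2 * q2 * nu2 \<mu> s a * G) * t
      + (- (q1 * eta1 \<mu> L s a) * N - (q2 * eta2 \<mu> L s a) * G)"
    unfolding b_ST_def C_ST_def using assms
    by (intro add_mono mult_right_mono[OF Bq] mult_right_mono[OF lin] C) auto
  also have "\<dots> = q1 * (t\<^sup>2 + 2 * nu1 \<mu> L s a * t - eta1 \<mu> L s a) * N
    + q2 * (t\<^sup>2 + 2 * nu2 \<mu> s a * t - eta2 \<mu> L s a) * G"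
    by (simp add: algebra_simps)
  finally show ?thesis unfolding N_def G_def .
qed

section \<open>Existence and lower bound of the stepsize\<close>

lemma b_ET_eventually_pos:
  fixes x v :: 'a and s a :: real
  assumes "s > 0" "g x \<noteq> 0"
  obtains t where "t > 0" "b_ET f g \<mu> L s a (x, v) t > 0"
proof -
  define m where "m = sqrt \<mu>"
  define r where "r = rt_mu_s \<mu> s"
  define gh where "gh = g (x + a *\<^sub>R v)"
  define N where "N = (norm v)\<^sup>2"
  define H where "H = (norm gh)\<^sup>2"
  \<comment> \<open>\<open>c\<close> and \<open>d\<close> are coefficients of a quadratic minorant
    of \<open>b_ET\<close>: the gradient increment is dropped by monotonicity, and strong convexity
    bounds the increment of \<open>f\<close>, which adds the last summand of
    \<open>c\<close>.\<close>
  define c where "c = m / 16 * (norm ((2 * m) *\<^sub>R v + r *\<^sub>R gh))\<^sup>2 + m * r\<^sup>2 / 16 * H + m * r * \<mu> / 8 * N"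
  define d where "d = 2 * \<mu> * N + r * (2 * m * (gh \<bullet> v) + r * H) - \<mu> / 4 * N
     + m * r / 4 * (g x \<bullet> v - v \<bullet> gh - m / L * H + m * ((a *\<^sub>R v) \<bullet> gh))"
  have m: "m > 0" "\<mu> = m * m" and r: "r \<ge> 1"
    using mu_pos rt_mu_s_ge_1[OF mu_pos assms(1)] by (auto simp: m_def r_def)
  \<comment> \<open>For \<open>v = 0\<close> the displaced gradient equals \<open>g x\<close>, which
    is nonzero; otherwise the term from strong convexity is positive.\<close>
  have "0 < m * r\<^sup>2 / 16 * H + m * r * \<mu> / 8 * N"
  proof (cases "v = 0")
    case True
    then show ?thesis using assms m r by (simp add: H_def gh_def N_def)
  next
    case False
    then show ?thesis using m r mu_pos
      by (intro add_nonneg_pos) (auto simp: N_def H_def)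
  qed
  then have "c > 0" unfolding c_def using m by (smt (verit) divide_nonneg_nonneg mult_nonneg_nonneg zero_le_power2)
  then obtain t where t: "t > 0" "c * t\<^sup>2 + d * t + C_ET f g \<mu> L s a (x, v) > 0"
    by (rule quadratic_eventually_pos)
  have "0 \<le> t * ((g (x + t *\<^sub>R v) - g x) \<bullet> v)"
    using gradient_strongly_monotone[where x=x and y="x + t *\<^sub>R v"] mu_pos
    by (smt (verit, best) add_diff_cancel_left' inner_scaleR_right mult_nonneg_nonneg zero_le_power2)
  then have "0 \<le> (g (x + t *\<^sub>R v) - g x) \<bullet> v" using t by (simp add: zero_le_mult_iff)
  then have 1: "0 \<le> r * ((g (x + t *\<^sub>R v) - g x) \<bullet> v)" using r by simp
  have "t * (g x \<bullet> v) + \<mu> / 2 * t\<^sup>2 * N \<le> f (x + t *\<^sub>R v) - f x"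
    using strongly_convex[of x "x + t *\<^sub>R v"] by (simp add: N_def power_mult_distrib)
  then have 2: "m * r / 4 * (t * (g x \<bullet> v) + \<mu> / 2 * t\<^sup>2 * N) \<le> m * r / 4 * (f (x + t *\<^sub>R v) - f x)"
    using m r by (intro mult_left_mono) auto
  have "c * t\<^sup>2 + d * t + C_ET f g \<mu> L s a (x, v) \<le> b_ET f g \<mu> L s a (x, v) t"
    using 1 2 unfolding b_ET_def A_ET_def B_ET_def Let_def fst_conv snd_conv m_def[symmetric]
      r_def[symmetric] gh_def[symmetric] N_def[symmetric] H_def[symmetric] c_def d_def
    by (simp add: power2_eq_square algebra_simps)
  with t that show thesis by fastforce
qed

lemma continuous_on_b_trig: "continuous_on UNIV (b_trig trig f g \<mu> L s a p)"
proof (cases trig)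
  case ET
  have "isCont (\<lambda>t. f (y + t *\<^sub>R v)) t" for y v t
    using has_real_derivative_along_line DERIV_isCont by blast
  then have cf: "continuous_on UNIV (\<lambda>t. f (y + t *\<^sub>R v))" for y v
    by (simp add: continuous_on_eq_continuous_at)
  have cg: "continuous_on UNIV (\<lambda>t. g (y + t *\<^sub>R v))" for y v
    by (rule continuous_on_compose2[OF lipschitz_on_continuous_on[OF lipschitz]])
      (auto intro!: continuous_intros)
  have "continuous_on UNIV (\<lambda>t. b_trig ET f g \<mu> L s a p t)"
    unfolding b_trig.simps b_ET_def A_ET_def B_ET_def Let_def divide_inverse
    by (intro continuous_on_const continuous_on_id cf cg continuous_on_add continuous_on_diff
        continuous_on_inner continuous_on_power continuous_on_mult)
  then show ?thesis by (simp add: ET)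
next
  case ST
  have "continuous_on UNIV (\<lambda>t. b_trig ST f g \<mu> L s a p t)"
    unfolding b_trig.simps b_ST_def
    by (intro continuous_on_const continuous_on_id continuous_on_add continuous_on_power continuous_on_mult)
  then show ?thesis by (simp add: ST)
qed

text \<open>Lets both triggers be treated at once: the lower bound transfers decay and eventual
  positivity, the upper bound the estimate of the stepsize.\<close>

lemma b_trig_bounds:
  assumes "s > 0" "t \<ge> 0"
  shows "b_ET f g \<mu> L s a p t \<le> b_trig trig f g \<mu> L s a p t"
    and "b_trig trig f g \<mu> L s a p t \<le> b_ST f g \<mu> L s a p t"
  using b_ET_le_b_ST[OF assms] by (cases trig; cases p; simp)+

text \<open>The trigger function is negative before \<open>MIET\<close> and positive somewhere
  later, so \<open>first_positive_zero\<close> yields the stepsize, which cannot lie before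
  \<open>MIET\<close>.\<close>

lemma step_properties:
  fixes p :: "'a \<times> 'a"
  assumes "s > 0" "\<mu> \<le> L" "0 < \<alpha>" "\<alpha> < 1" "0 \<le> a" "a \<le> a2_star \<alpha> \<mu> L s" "g (fst p) \<noteq> 0"
  shows "is_step trig f g \<mu> L s a p (step trig f g \<mu> L s a p)"
    and "MIET \<mu> L s a \<le> step trig f g \<mu> L s a p"
    and "t \<in> {0..step trig f g \<mu> L s a p} \<Longrightarrow> b_trig trig f g \<mu> L s a p t \<le> 0"
    and "0 < MIET \<mu> L s a"
proof -
  obtain x v where p: "p = (x, v)" by (cases p)
  note q1 = eta1_nu1_eq(1)[OF mu_pos L_pos assms(1), of a]
  note q2 = eta2_nu2_eq(1)[OF mu_pos L_pos assms(1)]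
  show miet: "0 < MIET \<mu> L s a"
    by (rule MIET_pos[OF eta_pos[OF mu_pos L_pos assms(1-6)]])
  have neg: "b_trig trig f g \<mu> L s a p t < 0" if t: "0 \<le> t" "t < MIET \<mu> L s a" for t
  proof -
    note t12 = below_MIET[OF nu2_pos[OF mu_pos assms(1,5)] t]
    have "b_trig trig f g \<mu> L s a p t \<le> b_ST f g \<mu> L s a p t"
      by (rule b_trig_bounds(2)[OF assms(1) t(1)])
    also have "\<dots> < 0"
      unfolding p
    proof (rule le_less_trans[OF b_ST_le[OF assms(1,5) t(1)] add_nonpos_neg])
      show "sqrt \<mu> / 8 * (rt_mu_s \<mu> s * L * (3 * a\<^sup>2 * rt_mu_s \<mu> s * L + 1) + 4 * \<mu>) *
          (t\<^sup>2 + 2 * nu1 \<mu> L s a * t - eta1 \<mu> L s a) * (norm v)\<^sup>2 \<le> 0"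
        using q1 t12(1) by (intro mult_nonpos_nonneg mult_nonneg_nonpos) auto
      \<comment> \<open>Strictness must come from this term, since \<open>v\<close> may vanish while
        \<open>g x\<close> does not.\<close>
      show "3 * (rt_mu_s \<mu> s)\<^sup>2 * sqrt \<mu> / 8 *
          (t\<^sup>2 + 2 * nu2 \<mu> s a * t - eta2 \<mu> L s a) * (norm (g x))\<^sup>2 < 0"
        using q2 t12(2) assms(7) by (intro mult_neg_pos mult_pos_neg) (auto simp: p)
    qed
    finally show ?thesis .
  qed
  obtain T where T: "T > 0" "b_ET f g \<mu> L s a p T > 0"
    using b_ET_eventually_pos[of s x a v] assms p by auto
  then have "b_trig trig f g \<mu> L s a p T > 0"
    using b_trig_bounds(1)[OF assms(1), of T a p trig] by simp
  then obtain d where d: "d > 0" "b_trig trig f g \<mu> L s a p d = 0"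
    "\<And>t. t > 0 \<Longrightarrow> b_trig trig f g \<mu> L s a p t = 0 \<Longrightarrow> d \<le> t"
    "\<And>t. t \<in> {0..d} \<Longrightarrow> b_trig trig f g \<mu> L s a p t \<le> 0"
    using first_positive_zero[OF continuous_on_b_trig neg[OF order_refl miet] T(1)] by metis
  then have is_step: "is_step trig f g \<mu> L s a p d" by (simp add: is_step_def)
  note step_eq = is_step_imp_step_eq[OF is_step]
  show "is_step trig f g \<mu> L s a p (step trig f g \<mu> L s a p)" using is_step step_eq by simp
  show "MIET \<mu> L s a \<le> step trig f g \<mu> L s a p"
    using neg[of d] d(1,2) unfolding step_eq by force
  show "t \<in> {0..step trig f g \<mu> L s a p} \<Longrightarrow> b_trig trig f g \<mu> L s a p t \<le> 0"
    using d(4) unfolding step_eq by blast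
qed

section \<open>Exponential decay along the iteration\<close>

lemma V_lyap_decrease_rate:
  fixes p :: "'a \<times> 'a"
  assumes "s > 0" "\<mu> \<le> L" "0 < \<alpha>" "\<alpha> < 1" "0 \<le> a" "a \<le> a2_star \<alpha> \<mu> L s" "g (fst p) \<noteq> 0"
    and t: "t \<in> {0..step trig f g \<mu> L s a p}"
  shows "\<exists>D. ((\<lambda>\<tau>. V_lyap f xstar \<mu> s (p + \<tau> *\<^sub>R X_hb g \<mu> s a p)) has_real_derivative D) (at t)
    \<and> D \<le> - (sqrt \<mu> / 4) * V_lyap f xstar \<mu> s (p + t *\<^sub>R X_hb g \<mu> s a p)"
proof -
  have t0: "t \<ge> 0" using t by simp
  have "b_ET f g \<mu> L s a p t \<le> 0"
    using step_properties(3)[OF assms] b_trig_bounds(1)[OF assms(1) t0, of a p trig] by linarith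
  moreover obtain D where
    "((\<lambda>\<tau>. V_lyap f xstar \<mu> s (p + \<tau> *\<^sub>R X_hb g \<mu> s a p)) has_real_derivative D) (at t)"
    "D + sqrt \<mu> / 4 * V_lyap f xstar \<mu> s (p + t *\<^sub>R X_hb g \<mu> s a p) \<le> b_ET f g \<mu> L s a p t"
    using V_lyap_derivative_le_b_ET[OF assms(1,5) t0, of "fst p" "snd p"] by auto
  ultimately show ?thesis by (intro exI[of _ D]) auto
qed

lemma V_lyap_step_le:
  fixes p :: "'a \<times> 'a" and trig :: trigger and s a :: real
  assumes "s > 0" "\<mu> \<le> L" "0 < \<alpha>" "\<alpha> < 1" "0 \<le> a" "a \<le> a2_star \<alpha> \<mu> L s" "g (fst p) \<noteq> 0"
  defines "d \<equiv> step trig f g \<mu> L s a p"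
  shows "V_lyap f xstar \<mu> s (p + d *\<^sub>R X_hb g \<mu> s a p) \<le> exp (- (sqrt \<mu> / 4) * d) * V_lyap f xstar \<mu> s p"
proof -
  define W where "W = (\<lambda>t. V_lyap f xstar \<mu> s (p + t *\<^sub>R X_hb g \<mu> s a p))"
  have "d \<ge> 0"
    using step_properties(2,4)[OF assms(1-7)] unfolding d_def by (meson less_imp_le order_trans)
  \<comment> \<open>Gronwall argument: the exponential is an integrating factor for the differential
    inequality, so the product is nonincreasing.\<close>
  then have "exp (sqrt \<mu> / 4 * d) * W d \<le> exp (sqrt \<mu> / 4 * 0) * W 0"
  proof (rule DERIV_nonpos_imp_nonincreasing)
    fix t assume "0 \<le> t" "t \<le> d"
    then obtain D where D: "(W has_real_derivative D) (at t)" "D \<le> - (sqrt \<mu> / 4) * W t"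
      using V_lyap_decrease_rate[OF assms(1-7), of t trig] unfolding W_def d_def by auto
    have "((\<lambda>t. exp (sqrt \<mu> / 4 * t) * W t) has_real_derivative
        exp (sqrt \<mu> / 4 * t) * (D + sqrt \<mu> / 4 * W t)) (at t)"
      by (auto intro!: derivative_eq_intros D(1) simp: algebra_simps)
    moreover have "exp (sqrt \<mu> / 4 * t) * (D + sqrt \<mu> / 4 * W t) \<le> 0"
      using D(2) by (intro mult_nonneg_nonpos) auto
    ultimately show "\<exists>y. ((\<lambda>t. exp (sqrt \<mu> / 4 * t) * W t) has_real_derivative y) (at t) \<and> y \<le> 0"
      by blast
  qed
  then have "exp (sqrt \<mu> / 4 * d) * W d \<le> W 0" by simp
  then have "exp (- (sqrt \<mu> / 4) * d) * (exp (sqrt \<mu> / 4 * d) * W d) \<le> exp (- (sqrt \<mu> / 4) * d) * W 0"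
    by (intro mult_left_mono) auto
  then show ?thesis unfolding W_def by (simp add: mult.assoc[symmetric] exp_add[symmetric])
qed

lemma gap_le_V_lyap: "f (fst p) - f xstar \<le> V_lyap f xstar \<mu> s p" if "s > 0"
proof -
  have "1 * (f (fst p) - f xstar) \<le> rt_mu_s \<mu> s * (f (fst p) - f xstar)"
    using rt_mu_s_ge_1[OF mu_pos that] minimizer[of "fst p"] by (intro mult_right_mono) auto
  then show ?thesis unfolding V_lyap_def Let_def
    by (smt (verit) mult_nonneg_nonneg zero_le_power2 divide_nonneg_nonneg)
qed

text \<open>The one-step factors multiply; reaching iterate \<open>Suc k\<close> takes the k + 1
  stepsizes with indices 0 to k.\<close>

lemma V_lyap_iterates_le:
  assumes "s > 0" "\<mu> \<le> L" "0 < \<alpha>" "\<alpha> < 1" "0 \<le> a" "a \<le> a2_star \<alpha> \<mu> L s"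
    and "\<And>i. i \<le> k \<Longrightarrow> g (fst (dg_iter trig f g \<mu> L s a p0 i)) \<noteq> 0"
  shows "V_lyap f xstar \<mu> s (dg_iter trig f g \<mu> L s a p0 (Suc k))
    \<le> V_lyap f xstar \<mu> s p0
       * exp (- (sqrt \<mu> / 4) * (\<Sum>i=0..k. step trig f g \<mu> L s a (dg_iter trig f g \<mu> L s a p0 i)))"
  using assms(7)
proof (induction k)
  case 0
  then show ?case using V_lyap_step_le[OF assms(1-6), of p0 trig] by (simp add: mult.commute)
next
  case (Suc k)
  let ?p = "dg_iter trig f g \<mu> L s a p0"
  let ?d = "\<lambda>i. step trig f g \<mu> L s a (?p i)"
  have "V_lyap f xstar \<mu> s (?p (Suc (Suc k))) \<le> exp (- (sqrt \<mu> / 4) * ?d (Suc k)) * V_lyap f xstar \<mu> s (?p (Suc k))"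
    using V_lyap_step_le[OF assms(1-6), of "?p (Suc k)" trig] Suc.prems[of "Suc k"]
    by (simp add: Let_def)
  also have "\<dots> \<le> exp (- (sqrt \<mu> / 4) * ?d (Suc k)) * (V_lyap f xstar \<mu> s p0 * exp (- (sqrt \<mu> / 4) * (\<Sum>i=0..k. ?d i)))"
    using Suc by (intro mult_left_mono) auto
  also have "\<dots> = V_lyap f xstar \<mu> s p0 * exp (- (sqrt \<mu> / 4) * (\<Sum>i=0..Suc k. ?d i))"
    by (simp add: distrib_left exp_add[symmetric] del: dg_iter.simps)
  finally show ?case .
qed

end

theorem mainTheorem4:
  fixes f :: "real ^ 'n \<Rightarrow> real"
    and g :: "real ^ 'n \<Rightarrow> real ^ 'n"
    and \<mu> L s \<alpha> a :: real
    and xstar :: "real ^ 'n"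
    and p0 :: "(real ^ 'n) \<times> (real ^ 'n)"
    and trig :: trigger
  assumes "\<mu> > 0" and "L > 0" and "s > 0"
    and gradient: "\<And>x. GDERIV f x :> g x"
    and C1: "continuous_on UNIV g"
    and strongly_convex:
      "\<And>x y. f y - f x \<ge> g x \<bullet> (y - x) + \<mu> / 2 * (norm (x - y))\<^sup>2"
    and lipschitz: "L-lipschitz_on UNIV g"
    and minimizer: "is_arg_min f (\<lambda>_. True) xstar"
    and "0 < \<alpha>" and "\<alpha> < 1"
    and "0 \<le> a" and "a \<le> a2_star \<alpha> \<mu> L s"
  shows
    "let p = dg_iter trig f g \<mu> L s a p0;
         \<Delta> = (\<lambda>k. step trig f g \<mu> L s a (p k));
         performed = dg_performed trig f g \<mu> L s a p0;
         V = V_lyap f xstar \<mu> s;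
         X = X_hb g \<mu> s a
     in
       (0 < beta1 \<mu> L s \<and> 0 < beta2 \<mu> s \<and> 0 < beta3 \<mu> \<and> 0 < beta4 \<mu> L s \<and> 0 < beta5 \<mu> L s)
     \<and> 0 < MIET \<mu> L s a
     \<and> (\<forall>\<epsilon>>0. \<forall>k. performed \<epsilon> k \<longrightarrow>
          is_step trig f g \<mu> L s a (p k) (\<Delta> k) \<and> MIET \<mu> L s a \<le> \<Delta> k)
     \<and> (\<forall>\<epsilon>>0. \<forall>k. performed \<epsilon> k \<longrightarrow>
          (\<forall>t\<in>{0..\<Delta> k}. \<exists>D.
             ((\<lambda>\<tau>. V (p k + \<tau> *\<^sub>R X (p k))) has_real_derivative D) (at t)
             \<and> D \<le> - (sqrt \<mu> / 4) * V (p k + t *\<^sub>R X (p k))))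
     \<and> (\<exists>K>0. \<forall>\<epsilon>>0. \<forall>k. performed \<epsilon> k \<longrightarrow>
          f (fst (p (Suc k))) - f xstar \<le> K * exp (- (sqrt \<mu> / 4) * (\<Sum>i=0..k. \<Delta> i)))"
proof -
  interpret strongly_convex_smooth f g \<mu> L xstar
    using assms(1,2) gradient strongly_convex lipschitz minimizer
    by unfold_locales (auto simp: is_arg_min_def not_less)
  \<comment> \<open>Index types are nonempty, so a coordinate vector supplies the nonzero vector for
    \<open>mu_le_L\<close>.\<close>
  have mu_L: "\<mu> \<le> L" by (rule mu_le_L[of "axis undefined 1"]) (simp add: axis_eq_0_iff)
  note hyps = \<open>s > 0\<close> mu_L \<open>0 < \<alpha>\<close> \<open>\<alpha> < 1\<close> \<open>0 \<le> a\<close> \<open>a \<le> a2_star \<alpha> \<mu> L s\<close>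
  let ?p = "dg_iter trig f g \<mu> L s a p0"
  have nz: "g (fst (?p i)) \<noteq> 0" if "\<epsilon> > 0" "dg_performed trig f g \<mu> L s a p0 \<epsilon> k" "i \<le> k" for \<epsilon> k i
    using that unfolding dg_performed_def by fastforce
  have miet: "0 < MIET \<mu> L s a"
    by (rule MIET_pos[OF eta_pos[OF mu_pos L_pos hyps]])
  \<comment> \<open>The summand 1 keeps the constant positive even if the Lyapunov function vanishes
    at \<open>p0\<close>; the constant depends neither on \<open>k\<close> nor on the
    tolerance.\<close>
  have rate: "f (fst (?p (Suc k))) - f xstar \<le> (\<bar>V_lyap f xstar \<mu> s p0\<bar> + 1)
      * exp (- (sqrt \<mu> / 4) * (\<Sum>i=0..k. step trig f g \<mu> L s a (?p i)))"
    if "\<epsilon> > 0" "dg_performed trig f g \<mu> L s a p0 \<epsilon> k" for \<epsilon> k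
    by (rule order_trans[OF gap_le_V_lyap[OF hyps(1)] order_trans[OF
          V_lyap_iterates_le[OF hyps nz[OF that]] mult_right_mono]]) auto
  show ?thesis
    unfolding Let_def
  proof (intro conjI allI impI ballI)
    show "0 < beta1 \<mu> L s" "0 < beta2 \<mu> s" "0 < beta3 \<mu>" "0 < beta4 \<mu> L s" "0 < beta5 \<mu> L s"
      by (fact beta_pos[OF mu_pos L_pos hyps(1,2)])+
    show "0 < MIET \<mu> L s a" by (fact miet)
    show "\<exists>K>0. \<forall>\<epsilon>>0. \<forall>k. dg_performed trig f g \<mu> L s a p0 \<epsilon> k \<longrightarrow>
        f (fst (?p (Suc k))) - f xstar \<le> K * exp (- (sqrt \<mu> / 4) * (\<Sum>i=0..k. step trig f g \<mu> L s a (?p i)))"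
      using rate by (intro exI[of _ "\<bar>V_lyap f xstar \<mu> s p0\<bar> + 1"]) (simp del: dg_iter.simps)
  next
    fix \<epsilon> :: real and k
    assume perf: "\<epsilon> > 0" "dg_performed trig f g \<mu> L s a p0 \<epsilon> k"
    note nz_k = nz[OF perf order_refl]
    show "is_step trig f g \<mu> L s a (?p k) (step trig f g \<mu> L s a (?p k))"
      "MIET \<mu> L s a \<le> step trig f g \<mu> L s a (?p k)"
      by (fact step_properties(1,2)[OF hyps nz_k])+
    show "\<exists>D. ((\<lambda>\<tau>. V_lyap f xstar \<mu> s (?p k + \<tau> *\<^sub>R X_hb g \<mu> s a (?p k))) has_real_derivative D) (at t)
        \<and> D \<le> - (sqrt \<mu> / 4) * V_lyap f xstar \<mu> s (?p k + t *\<^sub>R X_hb g \<mu> s a (?p k))"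
      if "t \<in> {0..step trig f g \<mu> L s a (?p k)}" for t
      by (fact V_lyap_decrease_rate[OF hyps nz_k that])
  qed
qed

end
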